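(* Let $\varphi$ be the substitution over $\{a,b\}$ given by $\varphi(a)=ab$ and $\varphi(b)=a^3b$. Then $G(\varphi)$ is not a relatively free profinite group.
   Context: A pseudovariety of groups is a class of finite groups closed under subgroups, homomorphic images and finite direct products. For a pseudovariety of groups $\mathsf V$ and a finite set $X$, $\overline\Omega_X\mathsf V$ is the pro-$\mathsf V$ group freely generated by $X$. A profinite group is relatively free if it is isomorphic (as a topological group) to $\overline\Omega_X\mathsf V$ for some pseudovariety of groups $\mathsf V$ and some finite set $X$. $\overline\Omega_A\mathsf S$ is the free profinite semigroup on the finite set $A$; the subsemigroup generated by $A$ is identified with the free semigroup $A^+$. A substitution over $A$ is an endomorphism $\varphi$ of $A^+$; it is primitive if there is $n\ge1$ such that every letter $c$ occurs in $\varphi^n(d)$ for all $c,d\in A$, and $\lim_n|\varphi^n(d)|=\infty$. A primitive $\varphi$ (such as the one in the claim) defines a minimal subshift $\mathcal X_\varphi\subseteq A^{\mathbb Z}$ whose language $L(\mathcal X_\varphi)$ of finite blocks consists of the words that are factors of $\varphi^k(c)$ for all $c\in A$ and all sufficiently large $k$. The closure of $L(\mathcal X_\varphi)$ in $\overline\Omega_A\mathsf S$ is the disjoint union of $L(\mathcal X_\varphi)$ and a regular $\mathcal J$-class $J(\varphi)$. The Schützenberger group $G(\varphi)$ is the profinite group isomorphic to the maximal subgroups of $J(\varphi)$ (which are all isomorphic). *)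

theory Defs
  imports
    "HOL-Library.Sublist"
    "HOL-Analysis.Function_Topology"
    "HOL-Algebra.Product_Groups"
begin

section \<open>The free profinite semigroup on a finite alphabet\<close>

text \<open>
  The alphabet is a finite type \<open>'a\<close> and the free semigroup on it is the set of nonempty lists.
  The free profinite semigroup is the projective limit of the \<open>'a\<close>-generated finite semigroups,
  that is, of the quotients of the free semigroup by its congruences of finite index, directed by
  inclusion of congruences.
\<close>

definition free_semigroup :: "'a list set" where
  "free_semigroup = {w. w \<noteq> []}"

definition fin_congs :: "'a list rel set" where
  "fin_congs = {r. equiv free_semigroup r
      \<and> (\<forall>u u' v v'. (u, u') \<in> r \<longrightarrow> (v, v') \<in> r \<longrightarrow> (u @ v, u' @ v') \<in> r)
      \<and> finite (free_semigroup // r)}"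

type_synonym 'a pro_word = "'a list rel \<Rightarrow> 'a list set"

definition pro_words :: "'a::finite pro_word set" where
  "pro_words = {x \<in> (\<Pi>\<^sub>E r\<in>fin_congs. free_semigroup // r).
      \<forall>r\<in>fin_congs. \<forall>s\<in>fin_congs. r \<subseteq> s \<longrightarrow> x r \<subseteq> x s}"

definition pro_mult :: "'a::finite pro_word \<Rightarrow> 'a pro_word \<Rightarrow> 'a pro_word" where
  "pro_mult x y = (\<lambda>r\<in>fin_congs. r `` {u @ v | u v. u \<in> x r \<and> v \<in> y r})"

definition pro_topology :: "'a::finite pro_word topology" where
  "pro_topology = subtopology
     (product_topology (\<lambda>r. discrete_topology (free_semigroup // r)) fin_congs) pro_words"

definition of_word :: "'a::finite list \<Rightarrow> 'a pro_word" where
  "of_word w = (\<lambda>r\<in>fin_congs. r `` {w})"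


section \<open>Substitutions and their Schuetzenberger groups\<close>

text \<open>
  A substitution, i.e. an endomorphism of the free semigroup, is given by the images \<open>f c\<close> of the
  letters; \<open>subst_ext f\<close> is its action on words.
\<close>

definition subst_ext :: "('a \<Rightarrow> 'a list) \<Rightarrow> 'a list \<Rightarrow> 'a list" where
  "subst_ext f w = concat (map f w)"

text \<open>The language of finite (nonempty) blocks of the subshift defined by a primitive substitution.\<close>

definition subst_language :: "('a::finite \<Rightarrow> 'a list) \<Rightarrow> 'a list set" where
  "subst_language f = {w \<in> free_semigroup.
      \<exists>K. \<forall>k\<ge>K. \<forall>c. sublist w ((subst_ext f ^^ k) [c])}"

text \<open>
  For primitive \<open>f\<close> the closure of the language is the disjoint union of the language itself and
  the regular J-class \<open>J(f)\<close>; this determines \<open>J(f)\<close>.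
\<close>

definition subst_J :: "('a::finite \<Rightarrow> 'a list) \<Rightarrow> 'a pro_word set" where
  "subst_J f = (pro_topology closure_of (of_word ` subst_language f)) - of_word ` subst_language f"

text \<open>
  A subgroup of a semigroup \<open>(S, m)\<close> is a subset that is a group under \<open>m\<close>; its identity is an
  idempotent of \<open>S\<close>, which need not be an identity of \<open>S\<close>.
\<close>

definition semigroup_subgroup :: "'b set \<Rightarrow> ('b \<Rightarrow> 'b \<Rightarrow> 'b) \<Rightarrow> 'b monoid \<Rightarrow> bool" where
  "semigroup_subgroup S m H \<longleftrightarrow> carrier H \<subseteq> S \<and> monoid.mult H = m \<and> group H"

definition maximal_subgroup :: "'b set \<Rightarrow> ('b \<Rightarrow> 'b \<Rightarrow> 'b) \<Rightarrow> 'b monoid \<Rightarrow> bool" where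
  "maximal_subgroup S m H \<longleftrightarrow> semigroup_subgroup S m H
      \<and> (\<forall>K. semigroup_subgroup S m K \<longrightarrow> carrier H \<subseteq> carrier K \<longrightarrow> carrier K = carrier H)"

text \<open>
  The Schuetzenberger group of \<open>f\<close> is only defined up to isomorphism: it is represented by any of
  the maximal subgroups contained in \<open>J(f)\<close>, with the topology induced by \<open>pro_topology\<close>.
\<close>

definition schuetzenberger_group :: "('a::finite \<Rightarrow> 'a list) \<Rightarrow> 'a pro_word monoid \<Rightarrow> bool" where
  "schuetzenberger_group f G \<longleftrightarrow> maximal_subgroup pro_words pro_mult G \<and> carrier G \<subseteq> subst_J f"

definition schuetzenberger_topology :: "'a::finite pro_word monoid \<Rightarrow> 'a pro_word topology" where
  "schuetzenberger_topology G = subtopology pro_topology (carrier G)"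


section \<open>Pseudovarieties of groups and relatively free profinite groups\<close>

text \<open>
  As every finite group is isomorphic to one whose carrier consists of natural numbers, a
  pseudovariety is given by its members of the latter kind. Closure under homomorphic images
  includes closure under isomorphic copies; the empty product puts the trivial groups into
  every pseudovariety.
\<close>

definition pseudovariety :: "nat monoid set \<Rightarrow> bool" where
  "pseudovariety V \<longleftrightarrow>
     (\<forall>G\<in>V. group G \<and> finite (carrier G)) \<and>
     (\<forall>G\<in>V. \<forall>H. subgroup H G \<longrightarrow> G\<lparr>carrier := H\<rparr> \<in> V) \<and>
     (\<forall>G\<in>V. \<forall>H::nat monoid. \<forall>h\<in>hom G H. group H \<longrightarrow> h ` carrier G = carrier H \<longrightarrow> H \<in> V) \<and>
     (\<forall>(I::nat set) G. \<forall>P::nat monoid. finite I \<longrightarrow> (\<forall>i\<in>I. G i \<in> V) \<longrightarrow>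
        group P \<longrightarrow> product_group I G \<cong> P \<longrightarrow> P \<in> V)"

text \<open>
  The pro-\<open>V\<close> group freely generated by a finite set \<open>X\<close> is the projective limit of the
  \<open>X\<close>-generated members of \<open>V\<close>, which are presented as pairs of a group in \<open>V\<close> and a generating
  map from \<open>X\<close> to it. The connecting maps are the homomorphisms compatible with the generating maps.
\<close>

definition generated_members :: "nat monoid set \<Rightarrow> 'x set \<Rightarrow> (nat monoid \<times> ('x \<Rightarrow> nat)) set" where
  "generated_members V X =
     {(K, g). K \<in> V \<and> g \<in> X \<rightarrow>\<^sub>E carrier K \<and> generate K (g ` X) = carrier K}"

definition free_pro_carrier ::
    "nat monoid set \<Rightarrow> 'x set \<Rightarrow> (nat monoid \<times> ('x \<Rightarrow> nat) \<Rightarrow> nat) set" where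
  "free_pro_carrier V X =
     {z \<in> (\<Pi>\<^sub>E p\<in>generated_members V X. carrier (fst p)).
        \<forall>(K, g)\<in>generated_members V X. \<forall>(L, k)\<in>generated_members V X. \<forall>h\<in>hom K L.
          (\<forall>i\<in>X. h (g i) = k i) \<longrightarrow> h (z (K, g)) = z (L, k)}"

definition free_pro ::
    "nat monoid set \<Rightarrow> 'x set \<Rightarrow> (nat monoid \<times> ('x \<Rightarrow> nat) \<Rightarrow> nat) monoid" where
  "free_pro V X = (product_group (generated_members V X) fst)\<lparr>carrier := free_pro_carrier V X\<rparr>"

definition free_pro_topology ::
    "nat monoid set \<Rightarrow> 'x set \<Rightarrow> (nat monoid \<times> ('x \<Rightarrow> nat) \<Rightarrow> nat) topology" where
  "free_pro_topology V X = subtopology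
     (product_topology (\<lambda>p. discrete_topology (carrier (fst p))) (generated_members V X))
     (free_pro_carrier V X)"

text \<open>
  A group with a topology on its carrier is relatively free if it is isomorphic, as a topological
  group, to a free pro-\<open>V\<close> group on a finite set, which may be taken to consist of natural numbers.
\<close>

definition relatively_free :: "'b monoid \<Rightarrow> 'b topology \<Rightarrow> bool" where
  "relatively_free G T \<longleftrightarrow>
     (\<exists>V (X::nat set). pseudovariety V \<and> finite X \<and>
        (\<exists>h\<in>iso G (free_pro V X). homeomorphic_map T (free_pro_topology V X) h))"


section \<open>The two-letter alphabet\<close>

datatype letter = letter_a | letter_b

instance letter :: finite
proof
  have "(UNIV :: letter set) = {letter_a, letter_b}"
    using letter.exhaust by blast
  then show "finite (UNIV :: letter set)"
    by (metis finite.emptyI finite.insertI)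
qed

end

theory Submission
  imports Defs "HOL-Algebra.Multiplicative_Group"
begin

text \<open>
  The group has no continuous homomorphism onto the group of order 2. Indeed it is topologically
  generated by conjugates of the limits of \<open>\<phi>\<^bsup>n!\<^esup>(a)\<close> and \<open>\<phi>\<^bsup>n!\<^esup>(b)\<close>, by uniqueness of desubstitution,
  and both letters occur an even number of times in \<open>\<phi>\<^bsup>n\<^esup>(a)\<close> and \<open>\<phi>\<^bsup>n\<^esup>(b)\<close> for \<open>n \<ge> 2\<close>.
  On the other hand some continuous finite quotient has even order: if \<open>a\<close> and \<open>b\<close> are mapped to
  elements of order 3 and 2 of the alternating group of degree 4, then so are all \<open>\<phi>\<^bsup>n\<^esup>(a)\<close> and
  \<open>\<phi>\<^bsup>n\<^esup>(b)\<close>. If the group were free pro-V, then V would contain a group of even order, hence the group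
  of order 2, which would then be a continuous quotient.
\<close>


section \<open>Congruences of finite index\<close>

text \<open>Modulo 2 the incidence matrix of \<open>\<phi>\<close> has square zero, which is the
  source of the parity statement. \<open>G\<close> is an arbitrary maximal subgroup in
  \<open>J(\<phi>)\<close>, whereas the limits of the images of letters lie in a particular one;
  hence the conjugation, by pro-words \<open>x\<close>, \<open>y\<close> with \<open>x y\<close> the
  identity of \<open>G\<close>. Exponents \<open>n!\<close> do not appear: each congruence
  \<open>r\<close> of finite index has its own \<open>n\<close> for which \<open>\<phi>^(2n)\<close>
  and \<open>\<phi>^n\<close> agree on letters modulo \<open>r\<close>, and an ultrafilter on the
  congruences turns these choices into pro-words. Generation is proved modulo one \<open>r\<close>
  at a time, which suffices since a continuous homomorphism to the group of order 2 factors through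
  some \<open>r\<close>. The obstacle is desubstitution: \<open>ab\<close> is a suffix of
  \<open>aaab\<close>, so a factor of the language may start inside a block. A prescribed long
  prefix and suffix exclude this; group elements have such representatives because their identity is
  absorbed on both sides and is, modulo \<open>r\<close>, a power of a long
  \<open>\<phi>^N(a)\<close>. The pair in the alternating group satisfies
  \<open>a^3 = b^2 = (ab)^3 = 1\<close>, so \<open>\<phi>\<close> sends \<open>(a, b)\<close> to
  \<open>(ab, b)\<close> and back.\<close>

lemma fin_congsD:
  assumes "r \<in> fin_congs"
  shows fin_congs_equiv: "equiv free_semigroup r"
    and fin_congs_append: "\<And>u u' v v'. (u, u') \<in> r \<Longrightarrow> (v, v') \<in> r \<Longrightarrow> (u @ v, u' @ v') \<in> r"
    and fin_congs_finite: "finite (free_semigroup // r)"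
  using assms by (auto simp: fin_congs_def)

lemma fin_congs_refl: "r \<in> fin_congs \<Longrightarrow> u \<noteq> [] \<Longrightarrow> (u, u) \<in> r"
  using fin_congs_equiv[of r] by (auto simp: equiv_def refl_on_def free_semigroup_def)

lemma fin_congs_sym: "r \<in> fin_congs \<Longrightarrow> (u, v) \<in> r \<Longrightarrow> (v, u) \<in> r"
  using fin_congs_equiv[of r] by (meson equiv_def symD)

lemma fin_congs_trans: "r \<in> fin_congs \<Longrightarrow> (u, v) \<in> r \<Longrightarrow> (v, w) \<in> r \<Longrightarrow> (u, w) \<in> r"
  using fin_congs_equiv[of r] by (meson equiv_def transD)

lemma fin_congs_nonempty: "r \<in> fin_congs \<Longrightarrow> (u, v) \<in> r \<Longrightarrow> u \<noteq> [] \<and> v \<noteq> []"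
  using fin_congs_equiv[of r] by (auto simp: equiv_def refl_on_def free_semigroup_def)

text \<open>Source of the concrete congruences below: the classes are fibres of \<open>f\<close>, so
  a finite image gives finite index.\<close>

lemma kernel_fin_congs:
  assumes "finite (f ` free_semigroup)"
    and "\<And>u u' v v'. u \<noteq> [] \<Longrightarrow> u' \<noteq> [] \<Longrightarrow> v \<noteq> [] \<Longrightarrow> v' \<noteq> [] \<Longrightarrow>
           f u = f u' \<Longrightarrow> f v = f v' \<Longrightarrow> f (u @ v) = f (u' @ v')"
  shows "{(u, v). u \<noteq> [] \<and> v \<noteq> [] \<and> f u = f v} \<in> fin_congs"
proof -
  let ?r = "{(u, v). u \<noteq> [] \<and> v \<noteq> [] \<and> f u = f v}"
  have "equiv free_semigroup ?r"
    by (rule equivI) (auto simp: refl_on_def free_semigroup_def sym_def trans_def)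
  moreover have "free_semigroup // ?r \<subseteq> (\<lambda>y. {v. v \<noteq> [] \<and> y = f v}) ` f ` free_semigroup"
    by (auto simp: quotient_def free_semigroup_def)
  then have "finite (free_semigroup // ?r)"
    using assms(1) finite_subset by blast
  ultimately show ?thesis
    using assms(2) unfolding fin_congs_def by auto
qed

lemma fin_congs_class_eq:
  "r \<in> fin_congs \<Longrightarrow> u \<noteq> [] \<Longrightarrow> v \<noteq> [] \<Longrightarrow> r `` {u} = r `` {v} \<longleftrightarrow> (u, v) \<in> r"
  using eq_equiv_class_iff[OF fin_congs_equiv, of r u v] by (simp add: free_semigroup_def)

lemma finite_classes: "r \<in> fin_congs \<Longrightarrow> finite ((\<lambda>u. r `` {u}) ` free_semigroup)"
  using fin_congs_finite[of r] by (simp add: quotient_def UNION_singleton_eq_range)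

lemma class_append:
  assumes "r \<in> fin_congs" "u \<noteq> []" "u' \<noteq> []" "v \<noteq> []" "v' \<noteq> []"
    "r `` {u} = r `` {u'}" "r `` {v} = r `` {v'}"
  shows "r `` {u @ v} = r `` {u' @ v'}"
  using assms fin_congs_append[OF assms(1)] by (simp add: fin_congs_class_eq)

lemma Int_fin_congs:
  assumes "r \<in> fin_congs" "s \<in> fin_congs"
  shows "r \<inter> s \<in> fin_congs"
proof -
  let ?f = "\<lambda>u. (r `` {u}, s `` {u})"
  have "?f ` free_semigroup \<subseteq>
      ((\<lambda>u. r `` {u}) ` free_semigroup) \<times> ((\<lambda>u. s `` {u}) ` free_semigroup)"
    by auto
  then have "finite (?f ` free_semigroup)"
    using finite_classes[OF assms(1)] finite_classes[OF assms(2)]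
    by (meson finite_SigmaI finite_subset)
  then have "{(u, v). u \<noteq> [] \<and> v \<noteq> [] \<and> ?f u = ?f v} \<in> fin_congs"
  proof (rule kernel_fin_congs)
    fix u u' v v' :: "'a list"
    assume ne: "u \<noteq> []" "u' \<noteq> []" "v \<noteq> []" "v' \<noteq> []" and "?f u = ?f u'" "?f v = ?f v'"
    then show "?f (u @ v) = ?f (u' @ v')"
      using class_append[OF assms(1) ne] class_append[OF assms(2) ne] by simp
  qed
  moreover have "(u, v) \<in> {(u, v). u \<noteq> [] \<and> v \<noteq> [] \<and> ?f u = ?f v} \<longleftrightarrow> (u, v) \<in> r \<inter> s" for u v
    using fin_congs_nonempty[OF assms(1), of u v] fin_congs_class_eq[OF assms(1), of u v]
      fin_congs_class_eq[OF assms(2), of u v] by auto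
  then have "{(u, v). u \<noteq> [] \<and> v \<noteq> [] \<and> ?f u = ?f v} = r \<inter> s"
    by (intro subset_antisym subrelI) blast+
  ultimately show ?thesis by simp
qed

text \<open>Directedness: a basic open set constrains finitely many coordinates, and one finer
  congruence controls them all. The empty family is served by the total congruence on nonempty
  words.\<close>

lemma Inter_fin_congs:
  assumes "finite F" "F \<subseteq> fin_congs"
  shows "\<exists>r\<in>fin_congs. \<forall>s\<in>F. r \<subseteq> s"
  using assms
proof (induction F)
  case empty
  have "{(u, v). u \<noteq> [] \<and> v \<noteq> [] \<and> () = ()} \<in> fin_congs"
    by (rule kernel_fin_congs) auto
  then show ?case by blast
next
  case (insert s F)
  then obtain r where "r \<in> fin_congs" "\<forall>s\<in>F. r \<subseteq> s"
    by auto
  then show ?case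
    using insert.prems by (intro bexI[of _ "r \<inter> s"] Int_fin_congs) auto
qed

text \<open>A word shorter than \<open>k\<close> is equivalent only to itself, so lengths below
  \<open>k\<close> are detected too. This congruence forces representatives of a pro-word to be
  long, or to have a prescribed prefix and suffix.\<close>

definition ends_cong :: "nat \<Rightarrow> 'a list rel" where
  "ends_cong k = {(u, v). u \<noteq> [] \<and> v \<noteq> [] \<and>
     (take k u, take k (rev u)) = (take k v, take k (rev v))}"

lemma take_append_take: "take k (take k u @ take k v) = take k (u @ v)"
  by (simp add: min_def)

lemma ends_cong_fin_congs: "ends_cong k \<in> (fin_congs :: 'a::finite list rel set)"
  unfolding ends_cong_def
proof (rule kernel_fin_congs)
  have fin: "finite {xs :: 'a list. set xs \<subseteq> UNIV \<and> length xs \<le> k}"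
    by (rule finite_lists_length_le) simp
  have "(\<lambda>u. (take k u, take k (rev u))) ` free_semigroup \<subseteq>
     {xs :: 'a list. set xs \<subseteq> UNIV \<and> length xs \<le> k} \<times> {xs. set xs \<subseteq> UNIV \<and> length xs \<le> k}"
    by auto
  then show "finite ((\<lambda>u. (take k u :: 'a list, take k (rev u))) ` free_semigroup)"
    using fin by (meson finite_SigmaI finite_subset)
next
  fix u u' v v' :: "'a list"
  assume "(take k u, take k (rev u)) = (take k u', take k (rev u'))"
    "(take k v, take k (rev v)) = (take k v', take k (rev v'))"
  then show "(take k (u @ v), take k (rev (u @ v))) = (take k (u' @ v'), take k (rev (u' @ v')))"
    using take_append_take[of k u v] take_append_take[of k u' v']
      take_append_take[of k "rev v" "rev u"] take_append_take[of k "rev v'" "rev u'"]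
    by (metis prod.inject rev_append)
qed

section \<open>Refining a congruence by the factorizations of words\<close>

definition factorizations :: "'a list rel \<Rightarrow> 'a list \<Rightarrow> ('a list set \<times> 'a list set) set" where
  "factorizations r w = {(r `` {u}, r `` {v}) | u v. u \<noteq> [] \<and> v \<noteq> [] \<and> w = u @ v}"

lemma factorizations_append:
  assumes "u \<noteq> []" "v \<noteq> []"
  shows "factorizations r (u @ v) =
    {(r `` {u1}, r `` {u2 @ v}) | u1 u2. u1 \<noteq> [] \<and> u2 \<noteq> [] \<and> u = u1 @ u2} \<union>
    {(r `` {u}, r `` {v})} \<union>
    {(r `` {u @ v1}, r `` {v2}) | v1 v2. v1 \<noteq> [] \<and> v2 \<noteq> [] \<and> v = v1 @ v2}"
    (is "_ = ?R")
proof
  show "factorizations r (u @ v) \<subseteq> ?R"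
  proof
    fix p assume "p \<in> factorizations r (u @ v)"
    then obtain x y where xy: "x \<noteq> []" "y \<noteq> []" "u @ v = x @ y" "p = (r `` {x}, r `` {y})"
      by (auto simp: factorizations_def)
    then obtain t where "(u = x @ t \<and> y = t @ v) \<or> (u @ t = x \<and> v = t @ y)"
      by (auto simp: append_eq_append_conv2)
    then show "p \<in> ?R"
      using xy by (cases "t = []") auto
  qed
  show "?R \<subseteq> factorizations r (u @ v)"
    using assms unfolding factorizations_def by (auto; metis append_assoc append_is_Nil_conv)
qed

lemma class_append_left:
  assumes "r \<in> fin_congs" "u \<noteq> []" "u' \<noteq> []" "v \<noteq> []" "v' \<noteq> []"
    "r `` {v} = r `` {v'}" "factorizations r u = factorizations r u'"
  shows "{(r `` {u1}, r `` {u2 @ v}) | u1 u2. u1 \<noteq> [] \<and> u2 \<noteq> [] \<and> u = u1 @ u2} \<subseteq>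
    {(r `` {u1}, r `` {u2 @ v'}) | u1 u2. u1 \<noteq> [] \<and> u2 \<noteq> [] \<and> u' = u1 @ u2}"
proof clarify
  fix u1 u2 assume u: "u1 \<noteq> []" "u2 \<noteq> []" "u = u1 @ u2"
  then have "(r `` {u1}, r `` {u2}) \<in> factorizations r u"
    unfolding factorizations_def by blast
  then have "(r `` {u1}, r `` {u2}) \<in> factorizations r u'"
    using assms(7) by simp
  then obtain u1' u2' where "u1' \<noteq> []" "u2' \<noteq> []" "u' = u1' @ u2'"
    "r `` {u1} = r `` {u1'}" "r `` {u2} = r `` {u2'}"
    by (auto simp: factorizations_def)
  moreover from this have "r `` {u2 @ v} = r `` {u2' @ v'}"
    using class_append[OF assms(1)] assms u by metis
  ultimately show "\<exists>u1' u2'. (r `` {u1}, r `` {u2 @ v}) = (r `` {u1'}, r `` {u2' @ v'}) \<and>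
      u1' \<noteq> [] \<and> u2' \<noteq> [] \<and> u' = u1' @ u2'"
    by blast
qed

lemma class_append_right:
  assumes "r \<in> fin_congs" "u \<noteq> []" "u' \<noteq> []" "v \<noteq> []" "v' \<noteq> []"
    "r `` {u} = r `` {u'}" "factorizations r v = factorizations r v'"
  shows "{(r `` {u @ v1}, r `` {v2}) | v1 v2. v1 \<noteq> [] \<and> v2 \<noteq> [] \<and> v = v1 @ v2} \<subseteq>
    {(r `` {u' @ v1}, r `` {v2}) | v1 v2. v1 \<noteq> [] \<and> v2 \<noteq> [] \<and> v' = v1 @ v2}"
proof clarify
  fix v1 v2 assume v: "v1 \<noteq> []" "v2 \<noteq> []" "v = v1 @ v2"
  then have "(r `` {v1}, r `` {v2}) \<in> factorizations r v"
    unfolding factorizations_def by blast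
  then have "(r `` {v1}, r `` {v2}) \<in> factorizations r v'"
    using assms(7) by simp
  then obtain v1' v2' where "v1' \<noteq> []" "v2' \<noteq> []" "v' = v1' @ v2'"
    "r `` {v1} = r `` {v1'}" "r `` {v2} = r `` {v2'}"
    by (auto simp: factorizations_def)
  moreover from this have "r `` {u @ v1} = r `` {u' @ v1'}"
    using class_append[OF assms(1)] assms v by metis
  ultimately show "\<exists>v1' v2'. (r `` {u @ v1}, r `` {v2}) = (r `` {u' @ v1'}, r `` {v2'}) \<and>
      v1' \<noteq> [] \<and> v2' \<noteq> [] \<and> v' = v1' @ v2'"
    by blast
qed

text \<open>The class modulo this refinement also determines, modulo \<open>r\<close>, every way to
  cut the word in two. This makes multiplication of pro-words open: a word close to a product can be
  cut into words close to the factors.\<close>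

definition factor_cong :: "'a list rel \<Rightarrow> 'a list rel" where
  "factor_cong r = {(u, v). u \<noteq> [] \<and> v \<noteq> [] \<and>
     (r `` {u}, factorizations r u) = (r `` {v}, factorizations r v)}"

lemma factor_cong_fin_congs:
  assumes "r \<in> fin_congs"
  shows "factor_cong r \<in> fin_congs"
  unfolding factor_cong_def
proof (rule kernel_fin_congs)
  let ?Q = "(\<lambda>u. r `` {u}) ` free_semigroup"
  have "(\<lambda>u. (r `` {u}, factorizations r u)) ` free_semigroup \<subseteq> ?Q \<times> Pow (?Q \<times> ?Q)"
    by (auto simp: factorizations_def free_semigroup_def)
  then show "finite ((\<lambda>u. (r `` {u}, factorizations r u)) ` free_semigroup)"
    by (rule finite_subset) (simp add: finite_classes[OF assms])
next
  fix u u' v v' :: "'a list"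
  assume ne: "u \<noteq> []" "u' \<noteq> []" "v \<noteq> []" "v' \<noteq> []"
    and "(r `` {u}, factorizations r u) = (r `` {u'}, factorizations r u')"
      "(r `` {v}, factorizations r v) = (r `` {v'}, factorizations r v')"
  then have eq: "r `` {u} = r `` {u'}" "factorizations r u = factorizations r u'"
      "r `` {v} = r `` {v'}" "factorizations r v = factorizations r v'"
    by auto
  have "factorizations r (u @ v) = factorizations r (u' @ v')"
    unfolding factorizations_append[OF ne(1,3)] factorizations_append[OF ne(2,4)]
    by (intro arg_cong2[where f = "(\<union>)"] subset_antisym
        class_append_left[OF assms(1) ne eq(3,2)] class_append_right[OF assms(1) ne eq(1,4)]
        class_append_left[OF assms(1) ne(2,1,4,3) eq(3)[symmetric] eq(2)[symmetric]]
        class_append_right[OF assms(1) ne(2,1,4,3) eq(1)[symmetric] eq(4)[symmetric]])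
      (auto simp: eq)
  then show "(r `` {u @ v}, factorizations r (u @ v)) = (r `` {u' @ v'}, factorizations r (u' @ v'))"
    using class_append[OF assms ne eq(1,3)] by simp
qed


section \<open>Pro-words\<close>

lemma pro_words_class:
  assumes "x \<in> pro_words" "r \<in> fin_congs" "u \<in> x r"
  shows "x r = r `` {u}" and "u \<noteq> []"
proof -
  have "x r \<in> free_semigroup // r"
    using assms(1,2) by (auto simp: pro_words_def)
  then obtain v where v: "x r = r `` {v}" "v \<in> free_semigroup"
    by (auto elim: quotientE)
  then show "u \<noteq> []"
    using assms(2,3) fin_congs_nonempty by blast
  then show "x r = r `` {u}"
    using assms v by (simp add: equiv_class_eq[OF fin_congs_equiv])
qed

lemma pro_words_ex: "x \<in> pro_words \<Longrightarrow> r \<in> fin_congs \<Longrightarrow> \<exists>u. u \<in> x r"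
  using in_quotient_imp_non_empty[OF fin_congs_equiv[of r]] by (fastforce simp: pro_words_def)

lemma pro_words_mem_iff:
  "x \<in> pro_words \<Longrightarrow> r \<in> fin_congs \<Longrightarrow> u \<in> x r \<Longrightarrow> v \<in> x r \<longleftrightarrow> (u, v) \<in> r"
  using pro_words_class(1)[of x r u] by auto

lemma pro_words_mono:
  assumes "x \<in> pro_words" "r \<in> fin_congs" "s \<in> fin_congs" "r \<subseteq> s" "u \<in> x r"
  shows "u \<in> x s"
proof -
  have "x r \<subseteq> x s"
    using assms(1-4) unfolding pro_words_def by blast
  then show ?thesis using assms(5) by blast
qed

lemma pro_words_level_eqI:
  "x \<in> pro_words \<Longrightarrow> y \<in> pro_words \<Longrightarrow> r \<in> fin_congs \<Longrightarrow> u \<in> x r \<Longrightarrow> u \<in> y r \<Longrightarrow> x r = y r"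
  using pro_words_class(1)[of x r u] pro_words_class(1)[of y r u] by simp

lemma pro_words_level_mono:
  assumes "x \<in> pro_words" "y \<in> pro_words" "r \<in> fin_congs" "s \<in> fin_congs" "r \<subseteq> s" "x r = y r"
  shows "x s = y s"
proof -
  obtain u where "u \<in> x r" "u \<in> y r"
    using pro_words_ex[OF assms(1,3)] assms(6) by auto
  then show ?thesis
    using pro_words_mono[OF assms(1,3-5)] pro_words_mono[OF assms(2,3-5)]
      pro_words_level_eqI[OF assms(1,2,4)] by blast
qed

lemma pro_words_eqI:
  assumes "x \<in> pro_words" "y \<in> pro_words" "\<And>r. r \<in> fin_congs \<Longrightarrow> \<exists>u. u \<in> x r \<and> u \<in> y r"
  shows "x = y"
proof (rule PiE_ext)
  show "x \<in> (\<Pi>\<^sub>E r\<in>fin_congs. free_semigroup // r)" "y \<in> (\<Pi>\<^sub>E r\<in>fin_congs. free_semigroup // r)"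
    using assms by (auto simp: pro_words_def)
  show "x r = y r" if "r \<in> fin_congs" for r
    using assms(3)[OF that] pro_words_level_eqI[OF assms(1,2) that] by blast
qed

text \<open>One common word suffices for compatibility: \<open>x r\<close> and \<open>x s\<close>
  are full classes, and \<open>r \<subseteq> s\<close> then carries the whole class along.\<close>

lemma pro_wordsI:
  assumes "\<And>r. r \<in> fin_congs \<Longrightarrow> \<exists>u. u \<noteq> [] \<and> x r = r `` {u}"
    and "\<And>r s. r \<in> fin_congs \<Longrightarrow> s \<in> fin_congs \<Longrightarrow> r \<subseteq> s \<Longrightarrow> \<exists>u. u \<in> x r \<and> u \<in> x s"
    and "x \<in> extensional fin_congs"
  shows "x \<in> pro_words"
proof -
  have "x r \<in> free_semigroup // r" if "r \<in> fin_congs" for r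
    using assms(1)[OF that] by (auto simp: free_semigroup_def intro: quotientI)
  moreover have "x r \<subseteq> x s" if rs: "r \<in> fin_congs" "s \<in> fin_congs" "r \<subseteq> s" for r s
  proof
    fix v assume v: "v \<in> x r"
    obtain u where u: "u \<in> x r" "u \<in> x s" using assms(2)[OF rs] by blast
    obtain u1 where u1: "x r = r `` {u1}" using assms(1)[OF rs(1)] by blast
    obtain u2 where u2: "x s = s `` {u2}" using assms(1)[OF rs(2)] by blast
    have "(u, v) \<in> r"
      using u v u1 fin_congs_sym[OF rs(1)] fin_congs_trans[OF rs(1)] by blast
    then show "v \<in> x s"
      using u2 u rs fin_congs_trans[OF rs(2)] by blast
  qed
  ultimately show ?thesis
    using assms(3) by (auto simp: pro_words_def PiE_def Pi_def)
qed

lemma pro_mult_level: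
  assumes "x \<in> pro_words" "y \<in> pro_words" "r \<in> fin_congs" "u \<in> x r" "v \<in> y r"
  shows "pro_mult x y r = r `` {u @ v}"
proof -
  have "(u @ v, w) \<in> r \<longleftrightarrow> (\<exists>t\<in>{u' @ v' | u' v'. u' \<in> x r \<and> v' \<in> y r}. (t, w) \<in> r)" for w
  proof
    assume "(u @ v, w) \<in> r"
    then show "\<exists>t\<in>{u' @ v' | u' v'. u' \<in> x r \<and> v' \<in> y r}. (t, w) \<in> r"
      using assms(4,5) by blast
  next
    assume "\<exists>t\<in>{u' @ v' | u' v'. u' \<in> x r \<and> v' \<in> y r}. (t, w) \<in> r"
    then obtain u' v' where u'v': "u' \<in> x r" "v' \<in> y r" "(u' @ v', w) \<in> r"
      by blast
    then have "(u @ v, u' @ v') \<in> r"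
      using pro_words_mem_iff[OF assms(1,3,4)] pro_words_mem_iff[OF assms(2,3,5)]
        fin_congs_append[OF assms(3)] by blast
    then show "(u @ v, w) \<in> r"
      using u'v'(3) fin_congs_trans[OF assms(3)] by blast
  qed
  then have "r `` {u' @ v' | u' v'. u' \<in> x r \<and> v' \<in> y r} = r `` {u @ v}"
    unfolding Image_def by blast
  then show ?thesis
    using assms(3) by (simp add: pro_mult_def)
qed

lemma pro_mult_mem:
  assumes "x \<in> pro_words" "y \<in> pro_words" "r \<in> fin_congs" "u \<in> x r" "v \<in> y r"
  shows "u @ v \<in> pro_mult x y r"
  unfolding pro_mult_level[OF assms]
  using fin_congs_refl[OF assms(3)] pro_words_class(2)[OF assms(1,3,4)] by auto

lemma pro_mult_closed [intro]:
  assumes "x \<in> pro_words" "y \<in> pro_words"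
  shows "pro_mult x y \<in> pro_words"
proof (rule pro_wordsI)
  fix r :: "'a list rel" assume r: "r \<in> fin_congs"
  obtain u v where uv: "u \<in> x r" "v \<in> y r"
    using pro_words_ex[OF assms(1)] pro_words_ex[OF assms(2)] r by blast
  show "\<exists>w. w \<noteq> [] \<and> pro_mult x y r = r `` {w}"
    using pro_mult_level[OF assms r uv] pro_words_class(2)[OF assms(1) r uv(1)] by (intro exI[of _ "u @ v"]) simp
next
  fix r s :: "'a list rel" assume r: "r \<in> fin_congs" "s \<in> fin_congs" "r \<subseteq> s"
  obtain u v where uv: "u \<in> x r" "v \<in> y r"
    using pro_words_ex[OF assms(1)] pro_words_ex[OF assms(2)] r by blast
  show "\<exists>w. w \<in> pro_mult x y r \<and> w \<in> pro_mult x y s"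
    using pro_mult_mem[OF assms r(1) uv] pro_mult_mem[OF assms r(2)]
      pro_words_mono[OF assms(1) r uv(1)] pro_words_mono[OF assms(2) r uv(2)] by blast
qed (simp add: pro_mult_def)

lemma pro_mult_assoc:
  assumes "x \<in> pro_words" "y \<in> pro_words" "z \<in> pro_words"
  shows "pro_mult (pro_mult x y) z = pro_mult x (pro_mult y z)"
proof (rule pro_words_eqI)
  fix r :: "'a list rel" assume r: "r \<in> fin_congs"
  obtain u v w where uvw: "u \<in> x r" "v \<in> y r" "w \<in> z r"
    using assms(1-3)[THEN pro_words_ex, OF r] by blast
  have "(u @ v) @ w \<in> pro_mult (pro_mult x y) z r" "u @ v @ w \<in> pro_mult x (pro_mult y z) r"
    by (intro pro_mult_mem pro_mult_closed assms r uvw)+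
  then show "\<exists>t. t \<in> pro_mult (pro_mult x y) z r \<and> t \<in> pro_mult x (pro_mult y z) r"
    by auto
qed (use assms in auto)


section \<open>The closure of a language\<close>

text \<open>For a pro-word and a set of nonempty words this is membership in the closure of the
  image of \<open>T\<close>, read off one level at a time.\<close>

definition adherent :: "'a::finite list set \<Rightarrow> 'a pro_word \<Rightarrow> bool" where
  "adherent T x \<longleftrightarrow> (\<forall>r\<in>fin_congs. \<exists>w\<in>T. w \<in> x r)"

lemma openin_pro_level:
  assumes "r \<in> fin_congs"
  shows "openin pro_topology {x \<in> pro_words. x r = c}"
proof -
  let ?T = "product_topology (\<lambda>r. discrete_topology (free_semigroup // r)) fin_congs
    :: 'a pro_word topology"
  have "continuous_map ?T (discrete_topology (free_semigroup // r)) (\<lambda>x. x r)"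
    using continuous_map_product_projection[OF assms, of "\<lambda>r. discrete_topology (free_semigroup // r)"]
    by simp
  then have "openin ?T {x \<in> topspace ?T. x r \<in> {c} \<inter> (free_semigroup // r)}"
    by (rule openin_continuous_map_preimage) simp
  then have "openin pro_topology (pro_words \<inter> {x \<in> topspace ?T. x r \<in> {c} \<inter> (free_semigroup // r)})"
    unfolding pro_topology_def by (rule openin_subtopology_Int2)
  moreover have "pro_words \<inter> {x \<in> topspace ?T. x r \<in> {c} \<inter> (free_semigroup // r)} =
      {x \<in> pro_words. x r = c}"
    using assms by (auto simp: pro_words_def)
  ultimately show ?thesis by simp
qed

lemma topspace_pro_topology [simp]: "topspace pro_topology = pro_words"
  by (auto simp: pro_topology_def pro_words_def)

text \<open>The finitely many constrained coordinates lie above one common refinement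
  \<open>r\<close>, and agreement at \<open>r\<close> propagates to coarser levels.\<close>

lemma openin_pro_topologyE:
  assumes "openin pro_topology U" "x \<in> U"
  obtains r where "r \<in> fin_congs" "\<And>y. y \<in> pro_words \<Longrightarrow> y r = x r \<Longrightarrow> y \<in> U"
proof -
  have xP: "x \<in> pro_words"
    using assms openin_subset by fastforce
  obtain U' where U': "openin (product_topology (\<lambda>r. discrete_topology (free_semigroup // r)) fin_congs) U'"
    "U = U' \<inter> pro_words"
    using assms(1) by (auto simp: pro_topology_def openin_subtopology)
  then obtain B where B: "finite {r \<in> fin_congs. B r \<noteq> free_semigroup // r}"
    "x \<in> Pi\<^sub>E fin_congs B" "Pi\<^sub>E fin_congs B \<subseteq> U'"
    using assms(2) by (fastforce simp: openin_product_topology_alt)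
  obtain r where r: "r \<in> fin_congs" "\<forall>s\<in>{r \<in> fin_congs. B r \<noteq> free_semigroup // r}. r \<subseteq> s"
    using Inter_fin_congs[OF B(1)] by auto
  show ?thesis
  proof (rule that[OF r(1)])
    fix y :: "'a pro_word" assume y: "y \<in> pro_words" "y r = x r"
    have "y s \<in> B s" if s: "s \<in> fin_congs" for s
    proof (cases "B s = free_semigroup // s")
      case True
      then show ?thesis using y(1) s by (auto simp: pro_words_def)
    next
      case False
      then have "y s = x s"
        using s r y xP by (intro pro_words_level_mono[of y x r s]) auto
      then show ?thesis using B(2) s by auto
    qed
    then have "y \<in> Pi\<^sub>E fin_congs B"
      using y(1) by (auto simp: pro_words_def PiE_def)
    then show "y \<in> U" using B(3) U'(2) y(1) by auto
  qed
qed

lemma closure_adherent: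
  assumes "T \<subseteq> free_semigroup" "x \<in> pro_topology closure_of (of_word ` T)"
  shows "adherent T x"
  unfolding adherent_def
proof
  fix r :: "'a list rel" assume r: "r \<in> fin_congs"
  have x: "x \<in> pro_words"
    using assms(2) closure_of_subset_topspace by fastforce
  have "x \<in> {y \<in> pro_words. y r = x r}" using x by simp
  then obtain w where w: "w \<in> T" "of_word w r = x r"
    using assms(2)[unfolded in_closure_of, THEN conjunct2, rule_format, OF conjI,
        OF _ openin_pro_level[OF r, of "x r"]] by auto
  then have "w \<in> x r"
    using r assms(1) fin_congs_refl[OF r, of w] by (auto simp: of_word_def free_semigroup_def)
  then show "\<exists>w\<in>T. w \<in> x r" using w by blast
qed

text \<open>Multiplication of pro-words is an open map.\<close>

lemma adherent_mult:
  assumes "adherent T (pro_mult x y)" "x \<in> pro_words" "y \<in> pro_words" "r \<in> fin_congs"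
  obtains u v where "u \<in> x r" "v \<in> y r" "u @ v \<in> T"
proof -
  \<comment> \<open>At the finer level a word of \<open>T\<close> has the same factorizations modulo
    \<open>r\<close> as a product of representatives, so it can be cut accordingly.\<close>
  let ?s = "factor_cong r"
  have s: "?s \<in> fin_congs" "?s \<subseteq> r"
    using factor_cong_fin_congs[OF assms(4)] fin_congs_class_eq[OF assms(4)]
    by (auto simp: factor_cong_def)
  obtain w where w: "w \<in> T" "w \<in> pro_mult x y ?s"
    using assms(1) s(1) by (auto simp: adherent_def)
  obtain u v where uv: "u \<in> x ?s" "v \<in> y ?s"
    using pro_words_ex[OF assms(2) s(1)] pro_words_ex[OF assms(3) s(1)] by blast
  have ne: "u \<noteq> []" "v \<noteq> []"
    using pro_words_class(2)[OF assms(2) s(1) uv(1)] pro_words_class(2)[OF assms(3) s(1) uv(2)] .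
  have "(u @ v, w) \<in> ?s"
    using w(2) pro_mult_level[OF assms(2,3) s(1) uv] by simp
  then have "factorizations r w = factorizations r (u @ v)"
    by (simp add: factor_cong_def)
  moreover have "(r `` {u}, r `` {v}) \<in> factorizations r (u @ v)"
    using ne unfolding factorizations_def by blast
  ultimately have "(r `` {u}, r `` {v}) \<in> factorizations r w"
    by simp
  then obtain u' v' where u'v': "r `` {u} = r `` {u'}" "r `` {v} = r `` {v'}"
    "u' \<noteq> []" "v' \<noteq> []" "w = u' @ v'"
    by (auto simp: factorizations_def)
  have "(u, u') \<in> r" "(v, v') \<in> r"
    using u'v' ne by (simp_all add: fin_congs_class_eq[OF assms(4)])
  then have "u' \<in> x r" "v' \<in> y r"
    using pro_words_mem_iff[OF assms(2,4) pro_words_mono[OF assms(2) s(1) assms(4) s(2) uv(1)]]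
      pro_words_mem_iff[OF assms(3,4) pro_words_mono[OF assms(3) s(1) assms(4) s(2) uv(2)]]
    by simp_all
  then show ?thesis using that u'v' w by blast
qed

lemma adherent_mult_factors:
  assumes "adherent T (pro_mult x y)" "x \<in> pro_words" "y \<in> pro_words"
    and T: "\<And>u v. u @ v \<in> T \<Longrightarrow> u \<noteq> [] \<Longrightarrow> v \<noteq> [] \<Longrightarrow> u \<in> T \<and> v \<in> T"
  shows "adherent T x" "adherent T y"
proof -
  have "(\<exists>w\<in>T. w \<in> x r) \<and> (\<exists>w\<in>T. w \<in> y r)" if r: "r \<in> fin_congs" for r
  proof -
    obtain u v where uv: "u \<in> x r" "v \<in> y r" "u @ v \<in> T"
      using adherent_mult[OF assms(1-3) r] .
    then show ?thesis
      using T[of u v] pro_words_class(2)[OF assms(2) r] pro_words_class(2)[OF assms(3) r] by blast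
  qed
  then show "adherent T x" "adherent T y"
    by (auto simp: adherent_def)
qed


section \<open>Compactness\<close>

text \<open>Zorn's lemma for proper filters below \<open>F\<close>: a minimal one decides every
  \<open>P\<close>, since meeting it with \<open>P\<close> gives either \<open>bot\<close> or the
  filter itself.\<close>

lemma ex_ultrafilter:
  fixes F :: "'b filter"
  assumes "F \<noteq> bot"
  shows "\<exists>U\<le>F. U \<noteq> bot \<and> (\<forall>P. eventually P U \<or> eventually (\<lambda>x. \<not> P x) U)"
proof -
  let ?A = "{G. G \<le> F \<and> G \<noteq> bot}"
  have "\<exists>U\<in>?A. \<forall>G\<in>?A. G \<le> U \<longrightarrow> G = U"
  proof (rule predicate_Zorn)
    show "partial_order_on ?A (relation_of (\<lambda>G H. H \<le> G) ?A)"
      by (rule partial_order_on_relation_ofI) auto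
    fix C assume C: "C \<in> Chains (relation_of (\<lambda>G H. H \<le> G) ?A)"
    show "\<exists>u\<in>?A. \<forall>a\<in>C. u \<le> a"
    proof (cases "C = {}")
      case True
      then show ?thesis using assms by auto
    next
      case False
      have CA: "C \<subseteq> ?A" using C by (rule Chains_relation_of)
      have ch: "G \<le> H \<or> H \<le> G" if "G \<in> C" "H \<in> C" for G H
        using C that by (auto simp: Chains_def relation_of_def)
      have "eventually P (Inf C) \<longleftrightarrow> (\<exists>b\<in>C. eventually P b)" for P
      proof (rule eventually_Inf_base[OF False])
        show "\<exists>K\<in>C. K \<le> inf G H" if "G \<in> C" "H \<in> C" for G H
          using ch[OF that] that by (auto simp: inf_absorb1 inf_absorb2)
      qed
      then have "Inf C \<noteq> bot"
        using CA by (auto simp: trivial_limit_def)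
      moreover have "Inf C \<le> F"
        using False CA by (auto intro: Inf_lower2)
      ultimately show ?thesis
        by (intro bexI[of _ "Inf C"]) (auto intro: Inf_lower)
    qed
  qed
  then obtain U where U: "U \<le> F" "U \<noteq> bot" "\<And>G. G \<le> U \<Longrightarrow> G \<noteq> bot \<Longrightarrow> G = U"
    by (metis (mono_tags, lifting) mem_Collect_eq order_trans)
  have "eventually P U \<or> eventually (\<lambda>x. \<not> P x) U" for P
  proof (cases "inf U (principal {x. P x}) = bot")
    case True
    then show ?thesis
      by (simp add: trivial_limit_def eventually_inf_principal)
  next
    case False
    then have "inf U (principal {x. P x}) = U" using U(3) by simp
    moreover have "eventually P (inf U (principal {x. P x}))"
      by (simp add: eventually_inf_principal)
    ultimately have "eventually P U" by simp
    then show ?thesis by simp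
  qed
  then show ?thesis using U by blast
qed

lemma ultrafilter_finite:
  assumes "\<And>P. eventually P U \<or> eventually (\<lambda>x. \<not> P x) U" "U \<noteq> bot"
    and "finite Q" "eventually (\<lambda>x. f x \<in> Q) U"
  shows "\<exists>c\<in>Q. eventually (\<lambda>x. f x = c) U"
proof (rule ccontr)
  assume "\<not> ?thesis"
  then have "\<forall>c\<in>Q. eventually (\<lambda>x. f x \<noteq> c) U"
    using assms(1) by blast
  then have "eventually (\<lambda>x. \<forall>c\<in>Q. f x \<noteq> c) U"
    using assms(3) by (simp add: eventually_ball_finite)
  then have "eventually (\<lambda>x. False) U"
    using assms(4) by eventually_elim auto
  then show False using assms(2) by (simp add: trivial_limit_def)
qed

text \<open>Limits are taken along an ultrafilter finer than the tails of the directed set of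
  congruences. By the second conclusion one stage \<open>s\<close> approximates finitely many limits
  \<open>X k\<close> together, so relations between the words of one stage pass to the
  limits.\<close>

lemma pro_words_compactness:
  fixes w :: "'a::finite list rel \<Rightarrow> 'k \<Rightarrow> 'a list"
  assumes "\<And>s k. s \<in> fin_congs \<Longrightarrow> w s k \<noteq> []"
  obtains X :: "'k \<Rightarrow> 'a pro_word" where "\<And>k. X k \<in> pro_words"
    and "\<And>r K. r \<in> fin_congs \<Longrightarrow> finite K \<Longrightarrow> \<exists>s\<in>fin_congs. s \<subseteq> r \<and> (\<forall>k\<in>K. w s k \<in> X k r)"
proof -
  define F where "F = (INF r\<in>fin_congs. principal {s \<in> fin_congs. s \<subseteq> (r :: 'a list rel)})"
  have ev: "eventually P F \<longleftrightarrow> (\<exists>r\<in>fin_congs. eventually P (principal {s \<in> fin_congs. s \<subseteq> r}))" for P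
    unfolding F_def
  proof (rule eventually_INF_base)
    show "fin_congs \<noteq> ({} :: 'a list rel set)" using Inter_fin_congs[of "{}"] by auto
    fix r s :: "'a list rel" assume "r \<in> fin_congs" "s \<in> fin_congs"
    then show "\<exists>t\<in>fin_congs. principal {q \<in> fin_congs. q \<subseteq> t} \<le>
        inf (principal {q \<in> fin_congs. q \<subseteq> r}) (principal {q \<in> fin_congs. q \<subseteq> s})"
      by (intro bexI[of _ "r \<inter> s"] Int_fin_congs) auto
  qed
  have "F \<noteq> bot"
    unfolding trivial_limit_def ev by (auto simp: eventually_principal)
  then obtain U where U: "U \<le> F" "U \<noteq> bot" "\<And>P. eventually P U \<or> eventually (\<lambda>x. \<not> P x) U"
    using ex_ultrafilter by blast
  have tail: "eventually (\<lambda>s. s \<in> fin_congs \<and> s \<subseteq> r) U" if "r \<in> fin_congs" for r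
  proof -
    have "eventually (\<lambda>s. s \<in> fin_congs \<and> s \<subseteq> r) F"
      unfolding ev using that by (intro bexI[of _ r]) (auto simp: eventually_principal)
    then show ?thesis using U(1) by (simp add: le_filter_def)
  qed
  have "\<exists>u. u \<noteq> [] \<and> eventually (\<lambda>s. w s k \<in> r `` {u}) U" if r: "r \<in> fin_congs" for r k
  proof -
    have "eventually (\<lambda>s. r `` {w s k} \<in> free_semigroup // r) U"
      using tail[OF r] by eventually_elim (simp add: assms free_semigroup_def quotientI)
    then obtain c where c: "c \<in> free_semigroup // r" "eventually (\<lambda>s. r `` {w s k} = c) U"
      using ultrafilter_finite[OF U(3,2) fin_congs_finite[OF r], of "\<lambda>s. r `` {w s k}"] by auto
    from c(1) obtain u where u: "u \<noteq> []" "c = r `` {u}"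
      by (auto simp: free_semigroup_def elim: quotientE)
    have "eventually (\<lambda>s. w s k \<in> r `` {u}) U"
      using c(2) tail[OF r]
    proof eventually_elim
      case (elim s)
      then have "w s k \<noteq> []" using assms by blast
      then have "w s k \<in> r `` {w s k}"
        using fin_congs_refl[OF r] by blast
      then show ?case using elim(1) u(2) by simp
    qed
    then show ?thesis using u by blast
  qed
  then obtain v where v: "\<And>r k. r \<in> fin_congs \<Longrightarrow> v r k \<noteq> []"
    "\<And>r k. r \<in> fin_congs \<Longrightarrow> eventually (\<lambda>s. w s k \<in> r `` {v r k}) U"
    by metis
  define X where "X k = (\<lambda>r\<in>fin_congs. r `` {v r k})" for k
  show ?thesis
  proof (rule that)
    show "X k \<in> pro_words" for k
    proof (rule pro_wordsI)
      fix r s :: "'a list rel" assume rs: "r \<in> fin_congs" "s \<in> fin_congs" "r \<subseteq> s"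
      have "eventually (\<lambda>q. w q k \<in> r `` {v r k} \<and> w q k \<in> s `` {v s k}) U"
        using v(2) rs by (simp add: eventually_conj_iff)
      then show "\<exists>u. u \<in> X k r \<and> u \<in> X k s"
        using eventually_happens'[OF U(2)] rs(1,2) by (fastforce simp: X_def)
    next
      show "\<exists>u. u \<noteq> [] \<and> X k r = r `` {u}" if "r \<in> fin_congs" for r :: "'a list rel"
        using v(1)[OF that, of k] that by (auto simp: X_def)
    qed (simp add: X_def)
    fix r :: "'a list rel" and K assume r: "r \<in> fin_congs" and K: "finite (K :: 'k set)"
    have "eventually (\<lambda>s. \<forall>k\<in>K. w s k \<in> r `` {v r k}) U"
      using v(2) r K by (simp add: eventually_ball_finite)
    with tail[OF r] have "eventually (\<lambda>s. (s \<in> fin_congs \<and> s \<subseteq> r) \<and> (\<forall>k\<in>K. w s k \<in> r `` {v r k})) U"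
      by (rule eventually_conj)
    from eventually_happens'[OF U(2) this]
    obtain s where "s \<in> fin_congs" "s \<subseteq> r" "\<forall>k\<in>K. w s k \<in> r `` {v r k}"
      by blast
    then show "\<exists>s\<in>fin_congs. s \<subseteq> r \<and> (\<forall>k\<in>K. w s k \<in> X k r)"
      using r by (intro bexI[of _ s]) (simp_all add: X_def)
  qed
qed


section \<open>Finite monoids\<close>

text \<open>Iteration in a finite set is eventually periodic; any multiple \<open>n\<close> of the
  period beyond the preperiod satisfies \<open>q (n + n) = q n\<close>.\<close>

lemma ex_period:
  fixes q :: "nat \<Rightarrow> 'b"
  assumes "finite (range q)" "\<And>k. q (Suc k) = t (q k)"
  shows "\<exists>n\<ge>c. q (n + n) = q n"
proof -
  have "\<not> inj q" using assms(1) finite_imageD by blast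
  then obtain i j where "i < j" "q i = q j"
    by (metis injI linorder_neqE_nat)
  then obtain d where d: "d > 0" "q (i + d) = q i"
    by (metis less_imp_add_positive)
  have step: "q (i + k + d) = q (i + k)" for k
    by (induction k) (use d assms(2) in auto)
  have mult: "q (i + k + l * d) = q (i + k)" for k l
  proof (induction l)
    case (Suc l)
    then show ?case using step[of "k + l * d"] by (simp add: algebra_simps)
  qed simp
  let ?n = "(i + c) * d"
  have "i + c \<le> ?n" using d(1) by simp
  moreover from this have "i + (?n - i) = ?n" by linarith
  then have "q (?n + ?n) = q ?n"
    using mult[of "?n - i" "i + c"] by simp
  ultimately show ?thesis by (meson add_leD2)
qed

text \<open>\<open>ex_period\<close> for the sequence of power maps on \<open>T\<close>, so that one
  exponent serves all elements. The bound 2 keeps \<open>m - 1\<close> positive, so that later a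
  power with exponent \<open>m - 1\<close> is a nonempty word.\<close>

lemma ex_idempotent_exponent:
  fixes T :: "'m::monoid_mult set"
  assumes "finite T" "\<And>x k. x \<in> T \<Longrightarrow> x ^ k \<in> T"
  shows "\<exists>m\<ge>2. \<forall>x\<in>T. x ^ m * x ^ m = x ^ m"
proof -
  let ?q = "\<lambda>k. \<lambda>x\<in>T. x ^ k"
  have "range ?q \<subseteq> (\<Pi>\<^sub>E x\<in>T. T)"
    using assms(2) by auto
  then have "finite (range ?q)"
    using assms(1) by (meson finite_PiE finite_subset)
  moreover have "?q (Suc k) = (\<lambda>g. \<lambda>x\<in>T. x * g x) (?q k)" for k
    by auto
  ultimately obtain m where m: "m \<ge> 2" "?q (m + m) = ?q m"
    using ex_period[of ?q "\<lambda>g. \<lambda>x\<in>T. x * g x" 2] by blast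
  have "x ^ m * x ^ m = x ^ m" if "x \<in> T" for x
    using fun_cong[OF m(2), of x] that by (simp add: power_add)
  then show ?thesis using m(1) by blast
qed

context monoid_mult
begin

text \<open>Iterating the equation gives \<open>x = p ^ m * x * y ^ m\<close>, where the idempotent
  is absorbed on the right.\<close>

lemma absorb_idempotent_power:
  assumes "x = p * x * y" "y ^ m * y ^ m = y ^ m"
  shows "x * y ^ m = x"
proof -
  have "x = p ^ k * x * y ^ k" for k
  proof (induction k)
    case (Suc k)
    have "x = p * (p ^ k * x * y ^ k) * y" using Suc assms(1) by metis
    also have "\<dots> = p ^ Suc k * x * (y ^ k * y)" by (simp add: mult_assoc)
    also have "y ^ k * y = y ^ Suc k" by (simp add: power_commutes)
    finally show ?case .
  qed simp
  then show ?thesis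
    using assms(2) by (metis mult_assoc)
qed

text \<open>In the local monoid with identity \<open>F\<close>, the element \<open>k\<close> is a
  two-sided factor of \<open>F\<close>. The idempotent powers stand in for finiteness and make
  \<open>k\<close> a unit, whose idempotent power can only be \<open>F\<close>.\<close>

lemma idempotent_power_of_factor:
  assumes F: "F * F = F" "k * F = k" "F * k = k" "F = c * k * d"
    and m: "m \<ge> 1"
    and idem: "(F * c * F) ^ m * (F * c * F) ^ m = (F * c * F) ^ m" "k ^ m * k ^ m = k ^ m"
  shows "k ^ m = F"
proof -
  obtain l where l: "m = Suc l" using m by (cases m) auto
  define p q where "p = F * c * F" and "q = F * d * F"
  have Fp: "F * p = p" "p * F = p" "F * q = q" "q * F = q"
    unfolding p_def q_def by (metis F(1) mult_assoc)+
  have pkq: "p * k * q = F"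
    unfolding p_def q_def by (metis F mult_assoc)
  have pw: "p ^ i * (k * q) ^ i = F" if "i \<ge> 1" for i
    using that
  proof (induction i rule: dec_induct)
    case base
    then show ?case using pkq by (simp add: mult_assoc)
  next
    case (step i)
    have "p ^ Suc i * (k * q) ^ Suc i = p * (p ^ i * (k * q) ^ i) * (k * q)"
      by (simp only: power_Suc[of p] power_Suc2[of "k * q"] mult_assoc)
    also have "\<dots> = F" using step pkq Fp by (metis mult_assoc)
    finally show ?case .
  qed
  have "p ^ m * F = F"
    using pw[OF m] idem(1) unfolding p_def[symmetric] by (metis mult_assoc)
  moreover have "p ^ m * F = p ^ m"
    using Fp(2) l by (metis mult_assoc power_Suc power_commutes)
  ultimately have pm: "p ^ m = F" by simp
  \<comment> \<open>As \<open>p\<close> is a unit, \<open>p * (k * q) = F\<close> implies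
    \<open>(k * q) * p = F\<close>, so \<open>k\<close> is right invertible.\<close>
  have "k * q * p = F * (k * q * p)" using F(3) by (metis mult_assoc)
  also have "\<dots> = p ^ l * (p * k * q) * p"
    using pm unfolding l power_Suc2 by (metis mult_assoc)
  also have "\<dots> = p ^ l * p"
    unfolding pkq using Fp(1) by (metis mult_assoc)
  also have "\<dots> = p ^ m" unfolding l power_Suc2 ..
  finally have kqp: "k * (q * p) = F" using pm by (simp add: mult_assoc)
  have FF: "F * (q * p) = q * p" using Fp by (metis mult_assoc)
  have kw: "k ^ i * (q * p) ^ i = F" if "i \<ge> 1" for i
    using that
  proof (induction i rule: dec_induct)
    case base
    then show ?case using kqp by simp
  next
    case (step i)
    have "k ^ Suc i * (q * p) ^ Suc i = k * (k ^ i * (q * p) ^ i) * (q * p)"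
      by (simp only: power_Suc[of k] power_Suc2[of "q * p"] mult_assoc)
    also have "\<dots> = F" using step kqp F(2) by (metis)
    finally show ?case .
  qed
  have "k ^ m * F = F"
    using kw[OF m] idem(2) by (metis mult_assoc)
  moreover have "k ^ m * F = k ^ m"
    using F(2) l by (metis mult_assoc power_Suc power_commutes)
  ultimately show ?thesis by simp
qed

text \<open>
  The hypotheses say that \<open>E\<close>, \<open>a\<close> and \<open>b\<close> lie in one regular J-class and that \<open>a\<close> and \<open>b\<close> lie
  in one maximal subgroup of it. The conclusion describes the isomorphism \<open>k \<mapsto> x k y\<close> of that
  subgroup onto the one containing \<open>E\<close>.
\<close>

lemma conjugate_idempotents:
  assumes T: "1 \<in> T" "\<And>x y. x \<in> T \<Longrightarrow> y \<in> T \<Longrightarrow> x * y \<in> T"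
    and idem: "\<And>x. x \<in> T \<Longrightarrow> x ^ m * x ^ m = x ^ m" and m: "m \<ge> 1"
    and inT: "{a, b, E, u, v, z, z', p, q, t, t', p', q'} \<subseteq> T"
    and E: "E * E = E" "E = u * a * v" "a = z * E * z'"
    and a: "a = p * a * a * q" "a = a * t * b"
    and b: "b = a * t' * b" "b = p' * b * a * q' * b"
  defines "F \<equiv> a ^ m" and "x \<equiv> E * u * a ^ m" and "y \<equiv> a * v * E"
  shows "y * x = F" "x * y = E" "F * a = a" "a * F = a" "F * b = b" "b * F = b" "b ^ m = F"
proof -
  obtain l where l: "m = Suc l" using m by (cases m) auto
  have T': "x ^ i \<in> T" if "x \<in> T" for x i
    using that T by (induction i) auto
  have inT': "a \<in> T" "b \<in> T" "E \<in> T" "u \<in> T" "v \<in> T" "z \<in> T" "z' \<in> T" "p \<in> T" "q \<in> T"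
    "t \<in> T" "t' \<in> T" "p' \<in> T" "q' \<in> T" using inT by auto
  have FF: "F * F = F" unfolding F_def by (rule idem[OF inT'(1)])
  have comm: "a * F = F * a" unfolding F_def by (rule power_commutes[symmetric])
  \<comment> \<open>\<open>a\<close> is a two-sided factor of itself through \<open>a * a\<close>;
    stability turns this into \<open>a = a * a * s\<close>, and iteration brings
    \<open>F = a ^ m\<close> to the front.\<close>
  have "a * (a * q) ^ m = a"
    by (rule absorb_idempotent_power[of _ p]) (use a(1) idem T inT' in \<open>simp_all add: mult_assoc\<close>)
  then have aa: "a = a * a * (q * (a * q) ^ l)"
    using l by (metis mult_assoc power_Suc)
  have "a = a ^ i * a * (q * (a * q) ^ l) ^ i" for i
  proof (induction i)
    case (Suc i)
    have "a = a ^ i * (a * a * (q * (a * q) ^ l)) * (q * (a * q) ^ l) ^ i"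
      using Suc aa by metis
    then show ?case
      by (simp add: mult_assoc power_commutes[symmetric])
  qed simp
  then have "a = F * a * (q * (a * q) ^ l) ^ m" unfolding F_def .
  then show Fa: "F * a = a" using FF by (metis mult_assoc)
  then show aF: "a * F = a" using comm by simp
  show Fb: "F * b = b" using b(1) Fa by (metis mult_assoc)
  have "F = a ^ l * (a * t * b)" using l a(2) by (simp add: F_def power_commutes)
  then have Fcb: "F = (a ^ l * a * t) * b" by (simp add: mult_assoc)
  \<comment> \<open>As \<open>b = p' * b * d\<close>, the power \<open>d ^ m\<close> is absorbed by
    \<open>b\<close>, hence by \<open>F\<close>, a left multiple of \<open>b\<close>. Since
    \<open>d\<close> starts with \<open>a\<close>, this forces \<open>d ^ m = F\<close>.\<close>
  define d where "d = a * q' * b"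
  have "b * d ^ m = b"
    by (rule absorb_idempotent_power[of _ p'])
      (use b(2) idem T inT' in \<open>simp_all add: mult_assoc d_def\<close>)
  then have "F * d ^ m = F" using Fcb by (metis mult_assoc)
  moreover have "F * d ^ m = d ^ m"
    using Fa l by (simp add: d_def mult_assoc[symmetric])
  ultimately have "d ^ m = F" by simp
  then show bF: "b * F = b" using \<open>b * d ^ m = b\<close> by simp
  have FT: "F \<in> T" using T' inT' by (simp add: F_def)
  show "b ^ m = F"
  proof (rule idempotent_power_of_factor[OF FF bF Fb _ m])
    show "F = (a ^ l * a * t) * b * 1" using Fcb by simp
  qed (use idem T T' inT' FT in auto)
  show xy: "x * y = E"
  proof -
    have "x * y = E * u * (F * a) * v * E" by (simp add: x_def y_def F_def mult_assoc)
    also have "\<dots> = E * (u * a * v) * E" using Fa by (simp add: mult_assoc)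
    also have "\<dots> = E" using E by metis
    finally show ?thesis .
  qed
  have Ex: "E * x = x" using E(1) by (simp add: x_def mult_assoc[symmetric])
  have k: "(y * x) * F = y * x" "F * (y * x) = y * x"
    using FF Fa by (metis x_def y_def F_def mult_assoc)+
  have idk: "(y * x) * (y * x) = y * x" using xy Ex by (metis mult_assoc)
  have "(y * x) ^ m = F"
  proof (rule idempotent_power_of_factor[OF FF k _ m])
    \<comment> \<open>\<open>F\<close> factors through \<open>y * x\<close> by way of
      \<open>E\<close> and \<open>a = z * E * z'\<close>; so the idempotent \<open>y * x\<close> is
      a unit of the local monoid and equals \<open>F\<close>.\<close>
    have "E = x * (y * x) * y" using xy E(1) by (metis mult_assoc)
    then have "a = (z * x) * (y * x) * (y * z')" using E(3) by (metis mult_assoc)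
    then show "F = (a ^ l * z * x) * (y * x) * (y * z')"
      using l by (metis F_def mult_assoc power_Suc power_commutes)
  qed (use idem T T' inT' FT in \<open>auto simp: x_def y_def\<close>)
  moreover have "(y * x) ^ Suc i = y * x" for i
    by (induction i) (use idk in simp_all)
  ultimately show "y * x = F" using l by metis
qed

end


section \<open>The action of words on congruence classes\<close>

text \<open>A copy of the function type that can be an instance of \<open>monoid_mult\<close>, so
  that the preceding lemmas on powers apply to transformations.\<close>

typedef 'b endo = "UNIV :: ('b \<Rightarrow> 'b) set" morphisms endo_app Endo by auto

instantiation endo :: (type) monoid_mult
begin
definition "1 = Endo id"
definition "f * g = Endo (endo_app g \<circ> endo_app f)"
instance
  by standard (simp_all add: one_endo_def times_endo_def Endo_inverse endo_app_inverse comp_assoc)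
end

text \<open>
  Products in \<open>endo\<close> are composed from left to right, which makes \<open>act r\<close> a homomorphism. The class
  of the empty word, which \<open>r\<close> does not see, is represented by the set \<open>{[]}\<close>.
\<close>

definition act :: "'a list rel \<Rightarrow> 'a list \<Rightarrow> 'a list set endo" where
  "act r u = Endo (if u = [] then id else (\<lambda>C. \<Union>c\<in>C. r `` {c @ u}))"

lemma act_Nil [simp]: "act r [] = 1"
  by (simp add: act_def one_endo_def)

lemma act_apply: "u \<noteq> [] \<Longrightarrow> endo_app (act r u) C = (\<Union>c\<in>C. r `` {c @ u})"
  by (simp add: act_def Endo_inverse)

lemma act_append:
  assumes "r \<in> fin_congs"
  shows "act r (u @ v) = act r u * act r v"
proof (cases "u = [] \<or> v = []")
  case False
  have "(\<Union>d\<in>\<Union>c\<in>C. r `` {c @ u}. r `` {d @ v}) = (\<Union>c\<in>C. r `` {c @ u @ v})" for C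
  proof -
    have "(\<Union>d\<in>r `` {c @ u}. r `` {d @ v}) = r `` {c @ u @ v}" for c
    proof -
      have "r `` {d @ v} = r `` {c @ u @ v}" if "(c @ u, d) \<in> r" for d
      proof -
        have "((c @ u) @ v, d @ v) \<in> r"
          using fin_congs_append[OF assms that] fin_congs_refl[OF assms] False by blast
        then show ?thesis
          using equiv_class_eq[OF fin_congs_equiv[OF assms]] by fastforce
      qed
      moreover have "(c @ u, c @ u) \<in> r" using fin_congs_refl[OF assms] False by simp
      ultimately show ?thesis by blast
    qed
    then show ?thesis by auto
  qed
  then have "endo_app (act r (u @ v)) C = endo_app (act r u * act r v) C" for C
    using False by (simp add: times_endo_def Endo_inverse act_apply)
  then show ?thesis
    by (metis ext endo_app_inject)
qed auto

text \<open>Applying the actions to \<open>{[]}\<close> recovers the classes, so the action is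
  faithful.\<close>

lemma act_eq_iff:
  assumes "r \<in> fin_congs" "u \<noteq> []" "v \<noteq> []"
  shows "act r u = act r v \<longleftrightarrow> (u, v) \<in> r"
proof
  assume "act r u = act r v"
  then have "endo_app (act r u) {[]} = endo_app (act r v) {[]}" by simp
  then show "(u, v) \<in> r"
    using assms by (simp add: act_apply fin_congs_class_eq)
next
  assume uv: "(u, v) \<in> r"
  have "r `` {c @ u} = r `` {c @ v}" for c
  proof (cases "c = []")
    case False
    then have "(c @ u, c @ v) \<in> r"
      using fin_congs_append[OF assms(1) _ uv] fin_congs_refl[OF assms(1)] by blast
    then show ?thesis
      using equiv_class_eq[OF fin_congs_equiv[OF assms(1)]] by blast
  qed (use equiv_class_eq[OF fin_congs_equiv[OF assms(1)] uv] in simp)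
  then show "act r u = act r v"
    using assms by (simp add: act_def)
qed

lemma finite_range_act:
  assumes "r \<in> fin_congs"
  shows "finite (range (act r))"
proof -
  have "act r ` free_semigroup = (\<lambda>c. act r (SOME u. u \<noteq> [] \<and> r `` {u} = c)) ` (\<lambda>u. r `` {u}) ` free_semigroup"
  proof (unfold image_image, rule image_cong[OF refl])
    fix u :: "'a list" assume "u \<in> free_semigroup"
    then have u: "u \<noteq> []" by (simp add: free_semigroup_def)
    then have "(SOME v. v \<noteq> [] \<and> r `` {v} = r `` {u}) \<noteq> [] \<and>
        r `` {SOME v. v \<noteq> [] \<and> r `` {v} = r `` {u}} = r `` {u}"
      by (intro someI_ex[of "\<lambda>v. v \<noteq> [] \<and> r `` {v} = r `` {u}"]) auto
    then show "act r u = act r (SOME v. v \<noteq> [] \<and> r `` {v} = r `` {u})"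
      using act_eq_iff[OF assms u] fin_congs_class_eq[OF assms _ u] fin_congs_sym[OF assms] by blast
  qed
  then have "finite (act r ` free_semigroup)"
    using finite_classes[OF assms] by simp
  moreover have "range (act r) \<subseteq> insert 1 (act r ` free_semigroup)"
    by (auto simp: free_semigroup_def)
  ultimately show ?thesis
    by (meson finite_insert finite_subset)
qed

lemma act_replicate: "r \<in> fin_congs \<Longrightarrow> act r (concat (replicate k u)) = act r u ^ k"
  by (induction k) (simp_all add: act_append)


section \<open>The substitution\<close>

lemma subst_ext_Nil [simp]: "subst_ext f [] = []"
  by (simp add: subst_ext_def)

lemma subst_ext_Cons: "subst_ext f (c # w) = f c @ subst_ext f w"
  by (simp add: subst_ext_def)

lemma subst_ext_append: "subst_ext f (u @ v) = subst_ext f u @ subst_ext f v"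
  by (simp add: subst_ext_def)

lemma subst_ext_pow_append:
  "(subst_ext f ^^ n) (u @ v) = (subst_ext f ^^ n) u @ (subst_ext f ^^ n) v"
  by (induction n) (simp_all add: subst_ext_append)

lemma subst_ext_pow_Nil [simp]: "(subst_ext f ^^ n) [] = []"
  by (induction n) simp_all

lemma subst_ext_pow_concat: "(subst_ext f ^^ n) w = concat (map (\<lambda>c. (subst_ext f ^^ n) [c]) w)"
proof (induction w)
  case (Cons c w)
  then show ?case using subst_ext_pow_append[of n f "[c]" w] by simp
qed simp

text \<open>A cut of an image falls between two blocks \<open>f c\<close> or strictly inside one;
  desubstitution amounts to excluding the second case.\<close>

lemma subst_ext_split:
  assumes "subst_ext f z = x @ w"
  shows "(\<exists>z1 z2. z = z1 @ z2 \<and> subst_ext f z1 = x \<and> subst_ext f z2 = w) \<or>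
    (\<exists>z1 c z2 x' s. z = z1 @ c # z2 \<and> x = subst_ext f z1 @ x' \<and> f c = x' @ s \<and>
       x' \<noteq> [] \<and> s \<noteq> [] \<and> w = s @ subst_ext f z2)"
  using assms
proof (induction z arbitrary: x)
  case (Cons d z)
  then have eq: "f d @ subst_ext f z = x @ w" by (simp add: subst_ext_Cons)
  show ?case
  proof (cases "length (f d) \<le> length x")
    case True
    then obtain t where t: "x = f d @ t" "subst_ext f z = t @ w"
      using eq by (metis append_eq_append_conv_if append_take_drop_id)
    from Cons.IH[OF t(2)] show ?thesis
    proof
      assume "\<exists>z1 z2. z = z1 @ z2 \<and> subst_ext f z1 = t \<and> subst_ext f z2 = w"
      then obtain z1 z2 where "z = z1 @ z2" "subst_ext f z1 = t" "subst_ext f z2 = w" by blast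
      then have "d # z = (d # z1) @ z2 \<and> subst_ext f (d # z1) = x \<and> subst_ext f z2 = w"
        using t by (simp add: subst_ext_Cons)
      then show ?thesis by blast
    next
      assume "\<exists>z1 c z2 x' s. z = z1 @ c # z2 \<and> t = subst_ext f z1 @ x' \<and> f c = x' @ s \<and>
        x' \<noteq> [] \<and> s \<noteq> [] \<and> w = s @ subst_ext f z2"
      then obtain z1 c z2 x' s where "z = z1 @ c # z2" "t = subst_ext f z1 @ x'" "f c = x' @ s"
        "x' \<noteq> []" "s \<noteq> []" "w = s @ subst_ext f z2" by blast
      then have "d # z = (d # z1) @ c # z2 \<and> x = subst_ext f (d # z1) @ x' \<and> f c = x' @ s \<and>
        x' \<noteq> [] \<and> s \<noteq> [] \<and> w = s @ subst_ext f z2"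
        using t by (simp add: subst_ext_Cons)
      then show ?thesis by blast
    qed
  next
    case False
    then obtain s where s: "f d = x @ s" "s \<noteq> []" "w = s @ subst_ext f z"
      using eq by (auto simp: append_eq_append_conv2)
    show ?thesis
    proof (cases "x = []")
      case True
      then have "d # z = [] @ (d # z) \<and> subst_ext f [] = x \<and> subst_ext f (d # z) = w"
        using s by (simp add: subst_ext_Cons)
      then show ?thesis by blast
    next
      case False
      then have "d # z = [] @ d # z \<and> x = subst_ext f [] @ x \<and> f d = x @ s \<and>
        x \<noteq> [] \<and> s \<noteq> [] \<and> w = s @ subst_ext f z"
        using s by simp
      then show ?thesis by blast
    qed
  qed
qed simp

text \<open>At most \<open>M\<close> letters of \<open>w\<close> are spent on the block in which it
  begins; more than \<open>M\<close> remain, and the next block fits.\<close>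

lemma block_factor:
  assumes "concat (map F z) = x @ w @ y" "\<And>c. length (F c) \<le> M" "length w > 2 * M"
  shows "\<exists>c p q. w = p @ F c @ q"
  using assms(1)
proof (induction z arbitrary: x)
  case Nil
  then show ?case using assms(3) by simp
next
  case (Cons d z)
  then have eq: "F d @ concat (map F z) = x @ w @ y" by simp
  then consider t where "concat (map F z) = t @ w @ y"
    | t where "F d = x @ t" "t @ concat (map F z) = w @ y"
    by (auto simp: append_eq_append_conv2)
  then show ?case
  proof cases
    case 1
    then show ?thesis using Cons.IH by blast
  next
    case 2
    have "length t \<le> M" using 2(1) assms(2)[of d] by simp
    then obtain w' where w': "w = t @ w'" "concat (map F z) = w' @ y" "length w' > M"
      using 2(2) assms(3) by (auto simp: append_eq_append_conv2)
    then obtain c z' where "z = c # z'" by (cases z) auto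
    then have "F c @ concat (map F z') = w' @ y" using w'(2) by simp
    moreover have "length (F c) < length w'" using w'(3) assms(2)[of c] by simp
    ultimately obtain q where "w' = F c @ q"
      by (auto simp: append_eq_append_conv2)
    then show ?thesis using w'(1) by blast
  qed
qed

locale letter_substitution =
  fixes f :: "letter \<Rightarrow> letter list"
  assumes f_a: "f letter_a = [letter_a, letter_b]"
    and f_b: "f letter_b = [letter_a, letter_a, letter_a, letter_b]"
begin

abbreviation "A \<equiv> letter_a"
abbreviation "B \<equiv> letter_b"
abbreviation "S \<equiv> subst_ext f"

lemma S_Cons [simp]: "S (A # w) = A # B # S w" "S (B # w) = A # A # A # B # S w"
  by (simp_all add: subst_ext_Cons f_a f_b)

lemma S_eq_Nil [simp]: "S w = [] \<longleftrightarrow> w = []"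
proof (cases w)
  case (Cons c z)
  then show ?thesis by (cases c) simp_all
qed simp

lemma S_pow_eq_Nil [simp]: "(S ^^ n) w = [] \<longleftrightarrow> w = []"
  by (induction n) simp_all

lemma last_S: "w \<noteq> [] \<Longrightarrow> last (S w) = B"
proof (induction w)
  case (Cons c w)
  then show ?case by (cases c; cases "w = []") simp_all
qed simp

lemma S_shape:
  assumes "w \<noteq> []"
  shows "\<exists>t. S w = A # t @ [B]"
proof -
  obtain c z where "w = c # z" using assms by (cases w) auto
  then obtain u where u: "S w = A # u" "u \<noteq> []" by (cases c) auto
  then have "u = butlast u @ [B]"
    using last_S[OF assms] append_butlast_last_id[OF u(2)] by simp
  then show ?thesis using u by metis
qed

text \<open>\<open>\<phi>^2(a) = abaaab\<close> and \<open>\<phi>^2(b) = abababaaab\<close>. The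
  factor \<open>aa\<close> and the initial \<open>aba\<close> will place the actions of
  \<open>\<phi>^n(a)\<close> and \<open>\<phi>^n(b)\<close> in one maximal subgroup.\<close>

lemma S_S_shape:
  assumes "w \<noteq> []"
  shows "\<exists>t. S (S w) = A # B # A # t @ [B]" "\<exists>u v. S (S w) = u @ [A, A] @ v"
proof -
  obtain c z where w: "w = c # z" using assms by (cases w) auto
  have "\<exists>u. S (S w) = A # B # A # u \<and> u \<noteq> []"
    using w by (cases c) auto
  then obtain u where u: "S (S w) = A # B # A # u" "u \<noteq> []" by blast
  moreover have "last (S (S w)) = B"
    using last_S[of "S w"] assms by simp
  ultimately have "u = butlast u @ [B]"
    using append_butlast_last_id[OF u(2)] by simp
  then show "\<exists>t. S (S w) = A # B # A # t @ [B]"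
    using u by metis
  have "S (S (A # z)) = [A, B] @ [A, A] @ [A, B] @ S (S z)"
    "S (S (B # z)) = [A, B, A, B, A, B] @ [A, A] @ [A, B] @ S (S z)" by simp_all
  then show "\<exists>u v. S (S w) = u @ [A, A] @ v"
    unfolding w by (cases c; metis)+
qed

lemma S_pow_shape:
  assumes "w \<noteq> []" "n \<ge> 2"
  shows "\<exists>t. (S ^^ n) w = A # B # A # t @ [B]" "\<exists>u v. (S ^^ n) w = u @ [A, A] @ v"
proof -
  have "(S ^^ n) w = S (S ((S ^^ (n - 2)) w))"
    using assms(2) by (metis add_2_eq_Suc' comp_apply diff_add_inverse2 funpow.simps(2) le_Suc_ex add.commute)
  then show "\<exists>t. (S ^^ n) w = A # B # A # t @ [B]" "\<exists>u v. (S ^^ n) w = u @ [A, A] @ v"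
    using S_S_shape assms by simp_all
qed

text \<open>The square of the incidence matrix has the entries 4, 6, 2, 4.\<close>

lemma even_count_S_S: "even (count_list (S (S w)) c)"
proof (induction w)
  case (Cons d w)
  then show ?case by (cases d; cases c) simp_all
qed simp

lemma even_count_S_pow: "n \<ge> 2 \<Longrightarrow> even (count_list ((S ^^ n) w) c)"
  using even_count_S_S[of "(S ^^ (n - 2)) w" c]
  by (metis add_2_eq_Suc' comp_apply funpow.simps(2) le_add_diff_inverse2)

section \<open>Desubstitution\<close>

lemma S_pow_starts: "\<exists>t. (S ^^ n) [A, B] = A # B # t"
proof (induction n)
  case (Suc n)
  then show ?case by auto
qed simp

text \<open>The letter \<open>b\<close> occurs only at the end of a block, so a cut after
  \<open>b\<close> separates blocks.\<close>

lemma S_cut_at_B: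
  assumes "S z = x @ w" "x = x' @ [B]"
  shows "\<exists>z1 z2. z = z1 @ z2 \<and> S z1 = x \<and> S z2 = w"
proof (rule ccontr)
  assume "\<not> ?thesis"
  then obtain z1 c y s where "x = S z1 @ y" "f c = y @ s" "y \<noteq> []" "s \<noteq> []"
    using subst_ext_split[OF assms(1)] by blast
  moreover from this have "last y = B" using assms(2) by (metis last_appendR last_snoc)
  ultimately show False
    by (cases c) (auto simp: f_a f_b Cons_eq_append_conv)
qed

lemma S_no_BB: "S z \<noteq> x @ [B, B] @ w"
proof
  assume "S z = x @ [B, B] @ w"
  then have "S z = (x @ [B]) @ B # w" by simp
  from S_cut_at_B[OF this] obtain z2 where z2: "S z2 = B # w" by blast
  then have "z2 \<noteq> []" by auto
  then show False using S_shape[of z2] z2 by auto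
qed

text \<open>The blocks \<open>ab\<close> and \<open>aaab\<close> differ in their second letter, so
  they form a prefix code.\<close>

lemma prefix_S:
  assumes "prefix (S u) (S v)"
  shows "prefix u v"
  using assms
proof (induction u arbitrary: v)
  case (Cons c u)
  then obtain d v' where v: "v = d # v'" by (cases v; cases c) auto
  show ?case
  proof (cases "c = d")
    case True
    then show ?thesis using Cons v by (cases c) auto
  next
    case False
    then show ?thesis using Cons.prems v by (cases c; cases d) auto
  qed
qed simp

lemma inj_S: "S u = S v \<Longrightarrow> u = v"
  by (metis prefix_S prefix_order.eq_iff)

text \<open>The blocks do not form a suffix code, which costs an extra application of
  \<open>\<phi>\<close>: if the occurrence starts inside a block, only the first letter of
  \<open>\<phi>^(m+1)(b)\<close> is lost, and \<open>\<phi>^m(b)\<close> is still a suffix of the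
  rest.\<close>

lemma suffix_S:
  assumes "suffix (S (S ((S ^^ m) [B]))) (S v)"
  shows "suffix ((S ^^ m) [B]) v"
proof -
  let ?X = "(S ^^ m) [B]"
  obtain y where y: "S v = y @ S (S ?X)" using assms by (auto simp: suffix_def)
  have SX: "S ?X = (S ^^ m) [A, A, A] @ ?X"
    using subst_ext_pow_append[of m f "[A, A, A]" "[B]"] by (simp add: funpow_swap1)
  show ?thesis
    using subst_ext_split[OF y]
  proof
    assume "\<exists>z1 z2. v = z1 @ z2 \<and> S z1 = y \<and> S z2 = S (S ?X)"
    then obtain z1 where "v = z1 @ S ?X" using inj_S by blast
    then show ?thesis using SX by (simp add: suffix_def)
  next
    assume "\<exists>z1 c z2 x' s. v = z1 @ c # z2 \<and> y = S z1 @ x' \<and> f c = x' @ s \<and>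
       x' \<noteq> [] \<and> s \<noteq> [] \<and> S (S ?X) = s @ S z2"
    then obtain z1 c z2 x' s where z: "v = z1 @ c # z2" "f c = x' @ s" "x' \<noteq> []"
      "S (S ?X) = s @ S z2" "s \<noteq> []" by blast
    obtain t where t: "S ?X = A # t" using S_shape[of ?X] by auto
    then have "A # B # S t = s @ S z2" using z(4) by simp
    \<comment> \<open>The leading \<open>ab\<close> can only be the tail of a block
      \<open>aaab\<close>.\<close>
    then have "S t = S z2"
      using z(2,3,5) by (cases c) (auto simp: f_a f_b Cons_eq_append_conv append_eq_Cons_conv)
    then have "t = z2" by (rule inj_S)
    moreover have "suffix ?X t"
    proof -
      obtain c' P where "(S ^^ m) [A, A, A] = c' # P"
        by (cases "(S ^^ m) [A, A, A]") auto
      then show ?thesis using SX t by (simp add: suffix_def)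
    qed
    ultimately show ?thesis using z(1) by (auto simp: suffix_def)
  qed
qed

text \<open>The final \<open>b\<close> fixes the right end. On the left, \<open>w\<close> begins
  with \<open>\<phi>(ab) = abaaab\<close>; if its first \<open>ab\<close> were the tail of a block
  \<open>aaab\<close>, another block \<open>aaab\<close> would follow, and \<open>S z\<close> would
  contain \<open>bb\<close>. The double \<open>S\<close> ensures that \<open>S z\<close> is itself
  an image and so free of \<open>bb\<close>.\<close>

lemma desubstitute_step:
  assumes "sublist w (S (S z))" "prefix (S u) w" "u = A # B # u'" "suffix [B] w"
  shows "\<exists>v. w = S v \<and> sublist v (S z)"
proof -
  obtain x y where xy: "S (S z) = x @ w @ y" using assms(1) by (auto simp: sublist_def)
  obtain w' where w': "w = w' @ [B]" using assms(4) by (auto simp: suffix_def)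
  have "S (S z) = (x @ w) @ y" "x @ w = (x @ w') @ [B]" using xy w' by simp_all
  from S_cut_at_B[OF this] obtain z1 z2 where z1: "S z = z1 @ z2" "S z1 = x @ w"
    by blast
  from subst_ext_split[OF z1(2)] show ?thesis
  proof
    assume "\<exists>z3 z4. z1 = z3 @ z4 \<and> S z3 = x \<and> S z4 = w"
    then obtain z3 z4 where "z1 = z3 @ z4" "S z4 = w" by blast
    then show ?thesis using z1(1) by (intro exI[of _ z4]) (auto simp: sublist_def)
  next
    assume "\<exists>z3 c z4 x' s. z1 = z3 @ c # z4 \<and> x = S z3 @ x' \<and> f c = x' @ s \<and>
       x' \<noteq> [] \<and> s \<noteq> [] \<and> w = s @ S z4"
    then obtain z3 c z4 x' s where z3: "z1 = z3 @ c # z4" "f c = x' @ s"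
       "x' \<noteq> []" "s \<noteq> []" "w = s @ S z4" by blast
    obtain q where q: "w = A # B # A # A # A # B # q"
      using assms(2,3) by (auto simp: prefix_def)
    have "c = B \<and> S z4 = A # A # A # B # q"
      using z3 q by (cases c) (auto simp: f_a f_b Cons_eq_append_conv append_eq_Cons_conv)
    moreover from this obtain d z5 where "z4 = d # z5" by (cases z4) auto
    moreover from calculation have "d = B" by (cases d) auto
    ultimately have "S z = z3 @ [B, B] @ (z5 @ z2)" using z3(1) z1(1) by simp
    then show ?thesis using S_no_BB by blast
  qed
qed

text \<open>
  An occurrence of \<open>\<phi>(ab)\<close> in the language cannot be preceded by \<open>aa\<close> inside a block
  \<open>\<phi>(b) = aaab\<close>, as that would need \<open>bb\<close> one level up; hence such a word is cut into blocks
  from its very beginning.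
\<close>

lemma desubstitute:
  assumes "sublist w ((S ^^ (Suc k + n)) [c])" "prefix ((S ^^ n) [A, B]) w"
    "suffix ((S ^^ (2 * n)) [B]) w"
  shows "\<exists>v. w = (S ^^ n) v"
  using assms
proof (induction n arbitrary: w)
  case (Suc n)
  obtain u' where u': "(S ^^ n) [A, B] = A # B # u'" using S_pow_starts by blast
  \<comment> \<open>Each step strips one \<open>\<phi>\<close> from the prefix but two from the
    suffix, by \<open>suffix_S\<close>; hence the exponent \<open>2 * n\<close>.\<close>
  have "(S ^^ (2 * Suc n)) [B] = S (S ((S ^^ (2 * n)) [B]))" by simp
  then have suf: "suffix (S (S ((S ^^ (2 * n)) [B]))) w" using Suc.prems(3) by simp
  moreover have "suffix [B] (S (S ((S ^^ (2 * n)) [B])))"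
    using S_shape[of "S ((S ^^ (2 * n)) [B])"] by (auto simp: suffix_def)
  ultimately have "suffix [B] w" by (meson suffix_order.trans)
  then obtain v where v: "w = S v" "sublist v (S ((S ^^ (k + n)) [c]))"
    using desubstitute_step[of w "(S ^^ (k + n)) [c]" "(S ^^ n) [A, B]" u'] Suc.prems u' by auto
  have "prefix ((S ^^ n) [A, B]) v" using Suc.prems(2) v(1) prefix_S by simp
  moreover have "suffix ((S ^^ (2 * n)) [B]) v" using suf v(1) suffix_S by simp
  ultimately obtain v' where "v = (S ^^ n) v'" using Suc.IH v(2) by auto
  then show ?case using v(1) by auto
qed auto

section \<open>The language of the subshift\<close>

abbreviation "L \<equiv> subst_language f"

lemma L_nonempty: "w \<in> L \<Longrightarrow> w \<noteq> []"
  by (auto simp: subst_language_def free_semigroup_def)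

lemma L_sublist: "w \<in> L \<Longrightarrow> \<exists>K. \<forall>k\<ge>K. sublist w ((S ^^ k) [A])"
  by (auto simp: subst_language_def)

lemma L_factors:
  assumes "u @ v \<in> L" "u \<noteq> []" "v \<noteq> []"
  shows "u \<in> L \<and> v \<in> L"
proof -
  obtain K where K: "\<And>k c. k \<ge> K \<Longrightarrow> sublist (u @ v) ((S ^^ k) [c])"
    using assms(1) by (auto simp: subst_language_def)
  have "sublist u (u @ v)" "sublist v (u @ v)" by simp_all
  then have "sublist u ((S ^^ k) [c])" "sublist v ((S ^^ k) [c])" if "k \<ge> K" for k c
    using K[OF that] sublist_order.order_trans by blast+
  then show ?thesis
    using assms(2,3) unfolding subst_language_def free_semigroup_def by blast
qed

text \<open>A long word contains a whole block \<open>\<phi>^(n+1)(c)\<close>, and such a block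
  begins with \<open>\<phi>^n(a)\<close> because \<open>\<phi>(c)\<close> begins with
  \<open>a\<close>.\<close>

lemma L_long:
  assumes "w \<in> L" "length w > 2 * (length ((S ^^ Suc n) [A]) + length ((S ^^ Suc n) [B]))"
  shows "\<exists>u v. w = u @ (S ^^ n) [A] @ v"
proof -
  obtain K where K: "\<And>k. k \<ge> K \<Longrightarrow> sublist w ((S ^^ k) [A])" using L_sublist[OF assms(1)] by blast
  have "sublist w ((S ^^ (Suc n + K)) [A])" by (rule K) simp
  then obtain x y where "concat (map (\<lambda>c. (S ^^ Suc n) [c]) ((S ^^ K) [A])) = x @ w @ y"
    unfolding funpow_add comp_apply subst_ext_pow_concat[of "Suc n" f "(S ^^ K) [A]"]
    by (auto simp: sublist_def)
  moreover have "length ((S ^^ Suc n) [c]) \<le>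
      length ((S ^^ Suc n) [A]) + length ((S ^^ Suc n) [B])" for c
    by (cases c) auto
  ultimately obtain c p q where "w = p @ (S ^^ Suc n) [c] @ q"
    using block_factor[of "\<lambda>c. (S ^^ Suc n) [c]"] assms(2) by blast
  moreover obtain t where "(S ^^ Suc n) [c] = (S ^^ n) [A] @ t"
  proof -
    obtain s where "S [c] = [A] @ s" using S_shape[of "[c]"] by auto
    then have "(S ^^ Suc n) [c] = (S ^^ n) [A] @ (S ^^ n) s"
      using subst_ext_pow_append[of n f "[A]" s] by (simp only: funpow_Suc_right comp_apply)
    then show ?thesis using that by blast
  qed
  ultimately have "w = p @ (S ^^ n) [A] @ (t @ q)" by simp
  then show ?thesis by blast
qed

end


section \<open>The maximal subgroups at finite level\<close>

context letter_substitution
begin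

text \<open>
  Modulo \<open>r\<close>, the words \<open>\<phi>\<^bsup>n\<^esup>(a)\<close> and \<open>\<phi>\<^bsup>n\<^esup>(b)\<close> lie in a group with identity \<open>v u\<close>, and \<open>w\<close>, which
  represents \<open>e\<close>, is the conjugate idempotent \<open>u v\<close>.
\<close>

definition frame ::
    "letter pro_word \<Rightarrow> letter list rel \<Rightarrow> nat \<Rightarrow> nat \<Rightarrow> letter list \<Rightarrow> letter list \<Rightarrow> letter list \<Rightarrow> bool" where
  "frame e r n m u v w \<longleftrightarrow> n \<ge> 2 \<and> m \<ge> 2 \<and> u \<noteq> [] \<and> v \<noteq> [] \<and> w \<in> e r \<and> w \<noteq> [] \<and>
     (\<forall>c. act r ((S ^^ (n + n)) [c]) = act r ((S ^^ n) [c])) \<and>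
     act r (u @ v) = act r w \<and> act r (w @ u) = act r u \<and> act r (v @ w) = act r v \<and>
     (\<forall>c. act r (v @ u @ (S ^^ n) [c]) = act r ((S ^^ n) [c]) \<and>
          act r ((S ^^ n) [c] @ v @ u) = act r ((S ^^ n) [c]) \<and>
          act r (concat (replicate m ((S ^^ n) [c]))) = act r (v @ u))"

lemma frame_mono:
  assumes "frame e s n m u v w" "s \<subseteq> r" "s \<in> fin_congs" "r \<in> fin_congs" "e \<in> pro_words"
  shows "frame e r n m u v w"
proof -
  have *: "act s x = act s y \<Longrightarrow> act r x = act r y" if "x \<noteq> []" "y \<noteq> []" for x y
    using that assms(2) act_eq_iff[OF assms(3) that] act_eq_iff[OF assms(4) that] by blast
  have "w \<in> e s" using assms(1) by (simp add: frame_def)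
  then have "w \<in> e r" using pro_words_mono[OF assms(5,3,4,2)] by blast
  then show ?thesis
    using assms(1) unfolding frame_def by (auto intro!: *)
qed

lemma act_S_pow_double:
  assumes "r \<in> fin_congs" "\<And>c. act r ((S ^^ (n + n)) [c]) = act r ((S ^^ n) [c])"
  shows "act r ((S ^^ (n + n)) w) = act r ((S ^^ n) w)"
proof (induction w)
  case (Cons c w)
  then show ?case
    using assms subst_ext_pow_append[of "n + n" f "[c]" w] subst_ext_pow_append[of n f "[c]" w]
    by (simp add: act_append)
qed simp

lemma act_S_pow_mult:
  assumes "r \<in> fin_congs" "\<And>c. act r ((S ^^ (n + n)) [c]) = act r ((S ^^ n) [c])"
  shows "act r ((S ^^ (Suc j * n)) w) = act r ((S ^^ n) w)"
proof (induction j)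
  case (Suc j)
  have "Suc (Suc j) * n = (n + n) + j * n" "Suc j * n = n + j * n" by simp_all
  then have "(S ^^ (Suc (Suc j) * n)) w = (S ^^ (n + n)) ((S ^^ (j * n)) w)"
    "(S ^^ (Suc j * n)) w = (S ^^ n) ((S ^^ (j * n)) w)"
    by (metis comp_apply funpow_add)+
  then show ?case using Suc act_S_pow_double[OF assms] by simp
qed simp

text \<open>Both \<open>w\<close> and \<open>w @ w\<close> represent the idempotent, and a word
  shorter than \<open>k\<close> cannot agree with its square in the first \<open>k\<close>
  letters.\<close>

lemma idempotent_long_word:
  assumes "r \<in> fin_congs" "e \<in> pro_words" "pro_mult e e = e" "adherent L e"
  obtains w where "w \<in> L" "w \<in> e r" "length w \<ge> k"
proof -
  let ?t = "r \<inter> ends_cong k"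
  have t: "?t \<in> fin_congs" using assms(1) ends_cong_fin_congs by (rule Int_fin_congs)
  obtain w where w: "w \<in> L" "w \<in> e ?t" using assms(4) t unfolding adherent_def by blast
  have "w @ w \<in> e ?t" using pro_mult_mem[OF assms(2,2) t w(2,2)] assms(3) by simp
  then have "(w, w @ w) \<in> ends_cong k" using pro_words_mem_iff[OF assms(2) t w(2)] by blast
  then have "length w \<ge> k" by (auto simp: ends_cong_def)
  moreover have "w \<in> e r" using pro_words_mono[OF assms(2) t assms(1) _ w(2)] by blast
  ultimately show ?thesis using that w by blast
qed

text \<open>A long word \<open>w\<close> of the language in the class of \<open>e\<close> contains
  \<open>\<phi>^n(a)\<close>, and conversely is a factor of an iterate of \<open>a\<close> that acts
  like \<open>\<phi>^n(a)\<close>. Thus both act in one J-class, and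
  \<open>conjugate_idempotents\<close> yields the conjugating words.\<close>

lemma frame_exists:
  assumes r: "r \<in> fin_congs" and e: "e \<in> pro_words" "pro_mult e e = e" "adherent L e"
  shows "\<exists>n m u v w. frame e r n m u v w"
proof -
  let ?T = "range (act r)"
  have act_app: "act r (x @ y) = act r x * act r y" for x y by (rule act_append[OF r])
  have Tmult: "x * y \<in> ?T" if "x \<in> ?T" "y \<in> ?T" for x y
    using that by (auto simp flip: act_app)
  have Tone: "1 \<in> ?T" using rangeI[of "act r" "[]"] by simp
  have Tpow: "x ^ k \<in> ?T" if "x \<in> ?T" for x k
    using that Tone Tmult by (induction k) auto
  \<comment> \<open>The pair of actions evolves by a fixed rule, so \<open>ex_period\<close> gives
    one \<open>n\<close> for both letters.\<close>
  define q where "q k = (act r ((S ^^ k) [A]), act r ((S ^^ k) [B]))" for k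
  have "range q \<subseteq> ?T \<times> ?T" by (auto simp: q_def)
  then have fin: "finite (range q)"
    using finite_range_act[OF r] by (meson finite_SigmaI finite_subset)
  have step: "q (Suc k) = (\<lambda>(x, y). (x * y, x * (x * (x * y)))) (q k)" for k
  proof -
    have "(S ^^ Suc k) [A] = (S ^^ k) ([A] @ [B])" "(S ^^ Suc k) [B] = (S ^^ k) ([A] @ [A] @ [A] @ [B])"
      by (simp_all add: funpow_swap1)
    then show ?thesis
      unfolding q_def subst_ext_pow_append by (simp only: act_app split)
  qed
  obtain n where n: "n \<ge> 2" "q (n + n) = q n"
    using ex_period[OF fin step] by blast
  have n2: "act r ((S ^^ (n + n)) [c]) = act r ((S ^^ n) [c])" for c
    using n(2) by (cases c) (simp_all add: q_def)
  obtain m where m: "m \<ge> 2" "\<And>x. x \<in> ?T \<Longrightarrow> x ^ m * x ^ m = x ^ m"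
    using ex_idempotent_exponent[OF finite_range_act[OF r]] Tpow by blast
  define a b where "a = (S ^^ n) [A]" and "b = (S ^^ n) [B]"
  obtain w where w: "w \<in> L" "w \<in> e r"
    "length w \<ge> Suc (2 * (length ((S ^^ Suc n) [A]) + length ((S ^^ Suc n) [B])))"
    using idempotent_long_word[OF r e] .
  then obtain u v where uv: "w = u @ a @ v"
    using L_long[OF w(1)] unfolding a_def by (metis Suc_le_eq)
  have ww: "act r w * act r w = act r w"
  proof -
    have "w @ w \<in> e r" using pro_mult_mem[OF e(1,1) r w(2,2)] e(2) by simp
    then have "(w @ w, w) \<in> r" using pro_words_mem_iff[OF e(1) r] w(2) by blast
    then have "act r (w @ w) = act r w"
      using act_eq_iff[OF r] L_nonempty[OF w(1)] by simp
    then show ?thesis by (simp add: act_app)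
  qed
  obtain K where K: "\<And>k. k \<ge> K \<Longrightarrow> sublist w ((S ^^ k) [A])" using L_sublist[OF w(1)] by blast
  \<comment> \<open>The exponent is a positive multiple of \<open>n\<close>, so as to act like
    \<open>n\<close>, and at least \<open>K\<close>, so as to contain \<open>w\<close>.\<close>
  have "K \<le> Suc K * n" using n(1) by (metis Suc_leD le_SucI le_refl mult_le_mono mult.right_neutral Suc_1)
  then obtain z z' where z: "(S ^^ (Suc K * n)) [A] = z @ w @ z'"
    using K[of "Suc K * n"] by (auto simp: sublist_def)
  have az: "act r a = act r z * act r w * act r z'"
    using act_S_pow_mult[OF r n2, of K "[A]"] unfolding z act_app a_def by (simp add: mult.assoc)
  \<comment> \<open>Since \<open>\<phi>^n(\<phi>^n(c))\<close> acts like \<open>\<phi>^n(c)\<close>,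
    letter patterns in \<open>\<phi>^n(c)\<close> become equations between the actions of
    \<open>\<phi>^n(a)\<close> and \<open>\<phi>^n(b)\<close>.\<close>
  have sub: "act r ((S ^^ n) [c]) = act r ((S ^^ n) ((S ^^ n) [c]))" for c
    using n2[of c] by (simp add: funpow_add)
  obtain p q where pq: "(S ^^ n) [A] = p @ [A, A] @ q" using S_pow_shape(2)[OF _ n(1), of "[A]"] by blast
  obtain t where t: "(S ^^ n) [A] = A # B # A # t @ [B]" using S_pow_shape(1)[OF _ n(1), of "[A]"] by blast
  obtain t' where t': "(S ^^ n) [B] = A # B # A # t' @ [B]" using S_pow_shape(1)[OF _ n(1), of "[B]"] by blast
  note letters = subst_ext_pow_append act_app mult.assoc
  have "act r a = act r ((S ^^ n) (p @ [A] @ [A] @ q))"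
    using sub[of A] pq by (simp add: a_def)
  then have aa: "act r a = act r ((S ^^ n) p) * act r a * act r a * act r ((S ^^ n) q)"
    by (simp only: letters a_def)
  have "act r a = act r ((S ^^ n) ([A] @ (B # A # t) @ [B]))"
    using sub[of A] t by (simp add: a_def)
  then have at: "act r a = act r a * act r ((S ^^ n) (B # A # t)) * act r b"
    by (simp only: letters a_def b_def)
  have "act r b = act r ((S ^^ n) ([A] @ (B # A # t') @ [B]))"
    using sub[of B] t' by (simp add: b_def)
  then have bt: "act r b = act r a * act r ((S ^^ n) (B # A # t')) * act r b"
    by (simp only: letters a_def b_def)
  have "act r b = act r ((S ^^ n) ([A] @ [B] @ [A] @ t' @ [B]))"
    using sub[of B] t' by (simp add: b_def)
  then have bp: "act r b = act r a * act r b * act r a * act r ((S ^^ n) t') * act r b"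
    by (simp only: letters a_def b_def)
  have wuv: "act r w = act r u * act r a * act r v" unfolding uv act_app by (simp add: mult.assoc)
  have m1: "m \<ge> 1" using m(1) by simp
  define x where "x = w @ u @ concat (replicate m a)"
  define y where "y = a @ v @ w"
  have actx: "act r x = act r w * act r u * act r a ^ m"
    unfolding x_def by (simp add: act_app act_replicate[OF r] mult.assoc)
  have acty: "act r y = act r a * act r v * act r w"
    unfolding y_def by (simp add: act_app mult.assoc)
  note conj = conjugate_idempotents[of ?T m "act r a" "act r b" "act r w", OF Tone Tmult m(2) m1
      _ ww wuv az aa at bt bp, folded actx acty]
  have F: "act r y * act r x = act r a ^ m" "act r x * act r y = act r w"
    "act r a ^ m * act r a = act r a" "act r a * act r a ^ m = act r a"
    "act r a ^ m * act r b = act r b" "act r b * act r a ^ m = act r b" "act r b ^ m = act r a ^ m"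
    using conj by auto
  have wx: "act r w * act r x = act r x" "act r y * act r w = act r y"
    unfolding actx acty using ww by (metis mult.assoc)+
  have abs: "act r ((S ^^ n) [c]) * act r a ^ m = act r ((S ^^ n) [c]) \<and>
      act r a ^ m * act r ((S ^^ n) [c]) = act r ((S ^^ n) [c]) \<and>
      act r ((S ^^ n) [c]) ^ m = act r a ^ m" for c
    using F(3-7) unfolding a_def b_def by (cases c) simp_all
  have "frame e r n m x y w"
    unfolding frame_def
  proof (intro conjI allI)
    show "x \<noteq> []" "y \<noteq> []" "w \<noteq> []" using L_nonempty[OF w(1)] by (simp_all add: x_def y_def)
    show "act r (x @ y) = act r w" "act r (w @ x) = act r x" "act r (y @ w) = act r y"
      using F(2) wx by (simp_all add: act_app)
    fix c
    show "act r (y @ x @ (S ^^ n) [c]) = act r ((S ^^ n) [c])"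
      using F(1) abs[of c] by (simp add: act_app mult.assoc[symmetric])
    show "act r ((S ^^ n) [c] @ y @ x) = act r ((S ^^ n) [c])"
      using F(1) abs[of c] by (simp add: act_app)
    show "act r (concat (replicate m ((S ^^ n) [c]))) = act r (y @ x)"
      using F(1) abs[of c] by (simp add: act_app act_replicate[OF r])
  qed (use n(1) m(1) w(2) n2 in auto)
  then show ?thesis by blast
qed

end

text \<open>Names of the words whose limits are formed together; \<open>Inverse c\<close> stands for
  the power of \<open>\<phi>^n(c)\<close> with exponent \<open>m - 1\<close>, its inverse in the
  group modulo \<open>r\<close>.\<close>

datatype limit_index = Entry | Exit | Image letter | Inverse letter

context letter_substitution
begin

text \<open>Frames chosen independently for each congruence, with varying \<open>n\<close> and
  \<open>m\<close>, are made coherent by compactness; the frame of a finer stage is then read at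
  level \<open>r\<close>.\<close>

lemma limit_frames:
  assumes e: "e \<in> pro_words" "pro_mult e e = e" "adherent L e"
  obtains x y W I where "x \<in> pro_words" "y \<in> pro_words" "\<And>c. W c \<in> pro_words" "\<And>c. I c \<in> pro_words"
    and "\<And>r. r \<in> fin_congs \<Longrightarrow> \<exists>n m u v w. frame e r n m u v w \<and> u \<in> x r \<and> v \<in> y r \<and>
      (\<forall>c. (S ^^ n) [c] \<in> W c r \<and> concat (replicate (m - 1) ((S ^^ n) [c])) \<in> I c r)"
proof -
  obtain n m u v w where fr: "\<And>s. s \<in> fin_congs \<Longrightarrow> frame e s (n s) (m s) (u s) (v s) (w s)"
    using frame_exists[OF _ e] by metis
  define words where "words s k = (case k of Entry \<Rightarrow> u s | Exit \<Rightarrow> v s | Image c \<Rightarrow> (S ^^ n s) [c]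
    | Inverse c \<Rightarrow> concat (replicate (m s - 1) ((S ^^ n s) [c])))" for s k
  have ne: "words s k \<noteq> []" if "s \<in> fin_congs" for s k
    using fr[OF that] by (auto simp: words_def frame_def split: limit_index.splits)
  from pro_words_compactness[of words, OF ne] obtain X where X: "\<And>k. X k \<in> pro_words"
    "\<And>r K. r \<in> fin_congs \<Longrightarrow> finite K \<Longrightarrow> \<exists>s\<in>fin_congs. s \<subseteq> r \<and> (\<forall>k\<in>K. words s k \<in> X k r)"
    by blast
  show ?thesis
  proof (rule that[of "X Entry" "X Exit" "\<lambda>c. X (Image c)" "\<lambda>c. X (Inverse c)"])
    fix r :: "letter list rel" assume r: "r \<in> fin_congs"
    have "finite ({Entry, Exit} \<union> range Image \<union> range Inverse)" by simp
    from X(2)[OF r this] obtain s where s: "s \<in> fin_congs" "s \<subseteq> r"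
      "\<And>k. k \<in> {Entry, Exit} \<union> range Image \<union> range Inverse \<Longrightarrow> words s k \<in> X k r" by blast
    have "frame e r (n s) (m s) (u s) (v s) (w s)"
      by (rule frame_mono[OF fr[OF s(1)] s(2,1) r e(1)])
    moreover have "u s \<in> X Entry r" "v s \<in> X Exit r"
      "(S ^^ n s) [c] \<in> X (Image c) r" "concat (replicate (m s - 1) ((S ^^ n s) [c])) \<in> X (Inverse c) r"
      for c
      using s(3)[of Entry] s(3)[of Exit] s(3)[of "Image c"] s(3)[of "Inverse c"]
      by (simp_all add: words_def)
    ultimately show "\<exists>n m u v w. frame e r n m u v w \<and> u \<in> X Entry r \<and> v \<in> X Exit r \<and>
      (\<forall>c. (S ^^ n) [c] \<in> X (Image c) r \<and> concat (replicate (m - 1) ((S ^^ n) [c])) \<in> X (Inverse c) r)"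
      by blast
  qed (rule X(1))+
qed

end


section \<open>The Schuetzenberger group\<close>

lemma pro_mult_level_cong:
  assumes "x \<in> pro_words" "y \<in> pro_words" "x' \<in> pro_words" "y' \<in> pro_words" "r \<in> fin_congs"
    "x r = x' r" "y r = y' r"
  shows "pro_mult x y r = pro_mult x' y' r"
  using assms by (simp add: pro_mult_def)

lemma pro_words_eqI_act:
  assumes "x \<in> pro_words" "y \<in> pro_words"
    and "\<And>r. r \<in> fin_congs \<Longrightarrow> \<exists>u v. u \<in> x r \<and> v \<in> y r \<and> act r u = act r v"
  shows "x = y"
proof (rule pro_words_eqI[OF assms(1,2)])
  fix r :: "'a list rel" assume r: "r \<in> fin_congs"
  obtain u v where uv: "u \<in> x r" "v \<in> y r" "act r u = act r v" using assms(3)[OF r] by blast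
  then have "(u, v) \<in> r"
    using act_eq_iff[OF r] pro_words_class(2)[OF assms(1) r] pro_words_class(2)[OF assms(2) r] by blast
  then have "v \<in> x r" using pro_words_mem_iff[OF assms(1) r uv(1)] by simp
  then show "\<exists>u. u \<in> x r \<and> u \<in> y r" using uv(2) by blast
qed

text \<open>The elements invertible relative to the identity of \<open>G\<close> form a subgroup
  containing \<open>G\<close>, which by maximality is \<open>G\<close>.\<close>

lemma maximal_subgroup_unit:
  assumes G: "maximal_subgroup pro_words pro_mult G" and z: "z \<in> pro_words" "z' \<in> pro_words"
    and "pro_mult \<one>\<^bsub>G\<^esub> z = z" "pro_mult z \<one>\<^bsub>G\<^esub> = z" "pro_mult \<one>\<^bsub>G\<^esub> z' = z'" "pro_mult z' \<one>\<^bsub>G\<^esub> = z'"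
      "pro_mult z z' = \<one>\<^bsub>G\<^esub>" "pro_mult z' z = \<one>\<^bsub>G\<^esub>"
  shows "z \<in> carrier G"
proof -
  define e where "e = \<one>\<^bsub>G\<^esub>"
  have grp: "group G" and sub: "carrier G \<subseteq> pro_words" and mult: "monoid.mult G = pro_mult"
    using G by (auto simp: maximal_subgroup_def semigroup_subgroup_def)
  interpret G: group G by (rule grp)
  have e: "e \<in> pro_words" "pro_mult e e = e"
    using sub G.one_closed G.l_one[OF G.one_closed] by (auto simp: e_def mult)
  define K where "K = \<lparr>carrier = {x \<in> pro_words. pro_mult e x = x \<and> pro_mult x e = x \<and>
      (\<exists>x'\<in>pro_words. pro_mult e x' = x' \<and> pro_mult x' e = x' \<and> pro_mult x x' = e \<and> pro_mult x' x = e)},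
    monoid.mult = pro_mult, one = e\<rparr>"
  have "group K"
  proof (rule groupI)
    fix x y assume "x \<in> carrier K" "y \<in> carrier K"
    then obtain x' y' where xy: "x \<in> pro_words" "y \<in> pro_words" "x' \<in> pro_words" "y' \<in> pro_words"
      "pro_mult e x = x" "pro_mult x e = x" "pro_mult e y = y" "pro_mult y e = y"
      "pro_mult e x' = x'" "pro_mult x' e = x'" "pro_mult e y' = y'" "pro_mult y' e = y'"
      "pro_mult x x' = e" "pro_mult x' x = e" "pro_mult y y' = e" "pro_mult y' y = e"
      by (auto simp: K_def)
    have 1: "pro_mult (pro_mult x y) (pro_mult y' x') = pro_mult (pro_mult x (pro_mult y y')) x'"
      "pro_mult (pro_mult y' x') (pro_mult x y) = pro_mult (pro_mult y' (pro_mult x' x)) y"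
      using xy(1-4) by (simp_all add: pro_mult_assoc pro_mult_closed)
    have 2: "pro_mult e (pro_mult x y) = pro_mult x y" "pro_mult e (pro_mult y' x') = pro_mult y' x'"
      "pro_mult (pro_mult x y) e = pro_mult x y" "pro_mult (pro_mult y' x') e = pro_mult y' x'"
      using xy pro_mult_assoc e(1) by metis+
    have "pro_mult y' x' \<in> pro_words" using xy by blast
    then show "x \<otimes>\<^bsub>K\<^esub> y \<in> carrier K"
      unfolding K_def using 1 2 xy by auto
  next
    fix x y z assume "x \<in> carrier K" "y \<in> carrier K" "z \<in> carrier K"
    then show "x \<otimes>\<^bsub>K\<^esub> y \<otimes>\<^bsub>K\<^esub> z = x \<otimes>\<^bsub>K\<^esub> (y \<otimes>\<^bsub>K\<^esub> z)"
      by (simp add: K_def pro_mult_assoc)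
  next
    fix x assume "x \<in> carrier K"
    then show "\<exists>y\<in>carrier K. y \<otimes>\<^bsub>K\<^esub> x = \<one>\<^bsub>K\<^esub>"
      unfolding K_def by auto
  qed (use e in \<open>auto simp: K_def\<close>)
  then have "semigroup_subgroup pro_words pro_mult K"
    by (auto simp: semigroup_subgroup_def K_def)
  moreover have "carrier G \<subseteq> carrier K"
  proof
    fix x assume x: "x \<in> carrier G"
    then have "inv\<^bsub>G\<^esub> x \<in> carrier G" by simp
    then show "x \<in> carrier K"
      using x sub G.l_one[OF x] G.r_one[OF x] G.l_inv[OF x] G.r_inv[OF x]
        G.l_one[of "inv\<^bsub>G\<^esub> x"] G.r_one[of "inv\<^bsub>G\<^esub> x"]
      by (auto simp: K_def mult e_def intro!: bexI[of _ "inv\<^bsub>G\<^esub> x"])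
  qed
  ultimately have "carrier K = carrier G" using G by (simp add: maximal_subgroup_def)
  moreover have "z \<in> carrier K" using assms by (auto simp: K_def e_def)
  ultimately show ?thesis by simp
qed

locale letter_schuetzenberger = letter_substitution +
  fixes G :: "letter pro_word monoid" (structure)
  assumes schuetzenberger: "schuetzenberger_group f G"
begin

lemma maximal: "maximal_subgroup pro_words pro_mult G"
  using schuetzenberger by (simp add: schuetzenberger_group_def)

lemma mult_eq: "monoid.mult G = pro_mult"
  and carrier_pro_words: "x \<in> carrier G \<Longrightarrow> x \<in> pro_words"
  using maximal by (auto simp: maximal_subgroup_def semigroup_subgroup_def)

sublocale group G
  using maximal by (simp add: maximal_subgroup_def semigroup_subgroup_def)

lemma adherent_carrier: "x \<in> carrier G \<Longrightarrow> adherent L x"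
  using schuetzenberger
  by (intro closure_adherent) (auto simp: schuetzenberger_group_def subst_J_def subst_language_def)

lemma one_pro_words: "\<one> \<in> pro_words"
  using carrier_pro_words one_closed by blast

lemma one_idem: "pro_mult \<one> \<one> = \<one>"
  using l_one[OF one_closed] by (simp add: mult_eq)

text \<open>\<open>x W(c) y\<close> belongs to \<open>G\<close> because \<open>x I(c) y\<close>
  inverts it, where \<open>I(c)\<close> is the limit of the words \<open>\<phi>^n(c)\<close> to the
  power \<open>m - 1\<close>. The identities are checked modulo each \<open>r\<close> through
  \<open>act\<close>.\<close>

lemma frames:
  obtains x y W where "x \<in> pro_words" "y \<in> pro_words" "\<And>c. W c \<in> pro_words"
    and "pro_mult x y = \<one>" "\<And>c. pro_mult (pro_mult x (W c)) y \<in> carrier G"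
    and "\<And>r. r \<in> fin_congs \<Longrightarrow> \<exists>n m u v w. frame \<one> r n m u v w \<and> u \<in> x r \<and> v \<in> y r \<and>
      (\<forall>c. (S ^^ n) [c] \<in> W c r)"
proof -
  obtain x y W I where P: "x \<in> pro_words" "y \<in> pro_words" "\<And>c. W c \<in> pro_words" "\<And>c. I c \<in> pro_words"
    and fr: "\<And>r. r \<in> fin_congs \<Longrightarrow> \<exists>n m u v w. frame \<one> r n m u v w \<and> u \<in> x r \<and> v \<in> y r \<and>
      (\<forall>c. (S ^^ n) [c] \<in> W c r \<and> concat (replicate (m - 1) ((S ^^ n) [c])) \<in> I c r)"
    using limit_frames[OF one_pro_words one_idem adherent_carrier[OF one_closed]] by metis
  have xy: "pro_mult x y = \<one>"
  proof (rule pro_words_eqI_act)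
    fix r :: "letter list rel" assume r: "r \<in> fin_congs"
    obtain n m u v w where *: "frame \<one> r n m u v w" "u \<in> x r" "v \<in> y r" using fr[OF r] by blast
    then have "u @ v \<in> pro_mult x y r" using P r by (intro pro_mult_mem)
    then show "\<exists>u v. u \<in> pro_mult x y r \<and> v \<in> \<one> r \<and> act r u = act r v"
      using *(1) unfolding frame_def by blast
  qed (use P one_pro_words in auto)
  have gen: "pro_mult (pro_mult x (W c)) y \<in> carrier G" (is "?g \<in> _") for c
  proof -
    let ?h = "pro_mult (pro_mult x (I c)) y"
    have gh: "?g \<in> pro_words" "?h \<in> pro_words" using P by auto
    have lev: "\<exists>u v w a b. u @ a @ v \<in> ?g r \<and> u @ b @ v \<in> ?h r \<and> w \<in> \<one> r \<and>
        act r w * act r u = act r u \<and> act r v * act r w = act r v \<and>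
        act r u * (act r a * (act r v * (act r u * (act r b * act r v)))) = act r w \<and>
        act r u * (act r b * (act r v * (act r u * (act r a * act r v)))) = act r w"
      if r: "r \<in> fin_congs" for r
    proof -
      obtain n m u v w where *: "frame \<one> r n m u v w" "u \<in> x r" "v \<in> y r"
        "(S ^^ n) [c] \<in> W c r" "concat (replicate (m - 1) ((S ^^ n) [c])) \<in> I c r"
        using fr[OF r] by blast
      define a b where "a = (S ^^ n) [c]" and "b = concat (replicate (m - 1) a)"
      have xW: "pro_mult x (W c) \<in> pro_words" "pro_mult x (I c) \<in> pro_words" using P by auto
      have "u @ a \<in> pro_mult x (W c) r" "u @ b \<in> pro_mult x (I c) r"
        using pro_mult_mem[OF P(1,3) r *(2,4)] pro_mult_mem[OF P(1,4) r *(2,5)]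
        by (simp_all add: a_def b_def)
      then have ab: "u @ a @ v \<in> ?g r" "u @ b @ v \<in> ?h r"
        using pro_mult_mem[OF xW(1) P(2) r _ *(3), of "u @ a"]
          pro_mult_mem[OF xW(2) P(2) r _ *(3), of "u @ b"] by simp_all
      have fr: "act r u * act r v = act r w" "act r w * act r u = act r u"
        "act r v * act r w = act r v" "act r a * (act r v * act r u) = act r a"
        "(act r v * act r u) * act r a = act r a"
        "act r a ^ m = act r v * act r u" "m \<ge> 2" "w \<in> \<one> r"
        using *(1) unfolding frame_def a_def
        by (simp_all add: act_append[OF r] act_replicate[OF r] mult.assoc)
      obtain l where l: "m = Suc (Suc l)" using fr(7) by (metis add_2_eq_Suc le_Suc_ex)
      have b: "act r b = act r a ^ Suc l" 
        unfolding b_def act_replicate[OF r] l by simp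
      have vub: "act r v * (act r u * act r b) = act r b"
        using fr(5) unfolding b power_Suc by (metis mult.assoc)
      have "act r u * (act r a * (act r v * (act r u * (act r b * act r v)))) =
          act r u * (act r a * act r b) * act r v"
        using vub by (metis mult.assoc)
      also have "act r a * act r b = act r v * act r u" using fr(6) unfolding b l by simp
      also have "act r u * (act r v * act r u) * act r v = act r w"
        using fr(1,2) by (metis mult.assoc)
      finally have 1: "act r u * (act r a * (act r v * (act r u * (act r b * act r v)))) = act r w" .
      have "act r u * (act r b * (act r v * (act r u * (act r a * act r v)))) =
          act r u * (act r b * act r a) * act r v"
        using fr(5) by (metis mult.assoc)
      also have "act r b * act r a = act r v * act r u"
        using fr(6) unfolding b l by (simp only: power_Suc2)
      also have "act r u * (act r v * act r u) * act r v = act r w"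
        using fr(1,2) by (metis mult.assoc)
      finally have "act r u * (act r b * (act r v * (act r u * (act r a * act r v)))) = act r w" .
      with 1 show ?thesis using ab fr(2,3,8) by blast
    qed
    have eqs: "pro_mult \<one> ?g = ?g" "pro_mult ?g \<one> = ?g" "pro_mult \<one> ?h = ?h" "pro_mult ?h \<one> = ?h"
      "pro_mult ?g ?h = \<one>" "pro_mult ?h ?g = \<one>"
    proof -
      have "\<exists>u v. u \<in> pro_mult \<one> ?g r \<and> v \<in> ?g r \<and> act r u = act r v"
           "\<exists>u v. u \<in> pro_mult ?g \<one> r \<and> v \<in> ?g r \<and> act r u = act r v"
           "\<exists>u v. u \<in> pro_mult \<one> ?h r \<and> v \<in> ?h r \<and> act r u = act r v"
           "\<exists>u v. u \<in> pro_mult ?h \<one> r \<and> v \<in> ?h r \<and> act r u = act r v"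
           "\<exists>u v. u \<in> pro_mult ?g ?h r \<and> v \<in> \<one> r \<and> act r u = act r v"
           "\<exists>u v. u \<in> pro_mult ?h ?g r \<and> v \<in> \<one> r \<and> act r u = act r v"
        if r: "r \<in> fin_congs" for r
      proof -
        from lev[OF r] obtain u v w a b where *: "u @ a @ v \<in> ?g r" "u @ b @ v \<in> ?h r" "w \<in> \<one> r"
          "act r w * act r u = act r u" "act r v * act r w = act r v"
          "act r u * (act r a * (act r v * (act r u * (act r b * act r v)))) = act r w"
          "act r u * (act r b * (act r v * (act r u * (act r a * act r v)))) = act r w" by blast
        note mem = pro_mult_mem[OF one_pro_words gh(1) r *(3,1)] pro_mult_mem[OF gh(1) one_pro_words r *(1,3)]
          pro_mult_mem[OF one_pro_words gh(2) r *(3,2)] pro_mult_mem[OF gh(2) one_pro_words r *(2,3)]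
          pro_mult_mem[OF gh r *(1,2)] pro_mult_mem[OF gh(2,1) r *(2,1)]
        have "act r (w @ u @ a @ v) = act r (u @ a @ v)" "act r ((u @ a @ v) @ w) = act r (u @ a @ v)"
          "act r (w @ u @ b @ v) = act r (u @ b @ v)" "act r ((u @ b @ v) @ w) = act r (u @ b @ v)"
          using *(4,5) by (simp_all add: act_append[OF r] mult.assoc) (simp_all flip: mult.assoc)
        moreover have "act r ((u @ a @ v) @ (u @ b @ v)) = act r w"
            "act r ((u @ b @ v) @ (u @ a @ v)) = act r w"
          using *(6,7) by (simp_all add: act_append[OF r] mult.assoc)
        ultimately show "\<exists>u v. u \<in> pro_mult \<one> ?g r \<and> v \<in> ?g r \<and> act r u = act r v"
           "\<exists>u v. u \<in> pro_mult ?g \<one> r \<and> v \<in> ?g r \<and> act r u = act r v"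
           "\<exists>u v. u \<in> pro_mult \<one> ?h r \<and> v \<in> ?h r \<and> act r u = act r v"
           "\<exists>u v. u \<in> pro_mult ?h \<one> r \<and> v \<in> ?h r \<and> act r u = act r v"
           "\<exists>u v. u \<in> pro_mult ?g ?h r \<and> v \<in> \<one> r \<and> act r u = act r v"
           "\<exists>u v. u \<in> pro_mult ?h ?g r \<and> v \<in> \<one> r \<and> act r u = act r v"
          using mem *(1-3) by blast+
      qed
      note ex = this
      have closed: "pro_mult \<one> ?g \<in> pro_words" "pro_mult ?g \<one> \<in> pro_words"
        "pro_mult \<one> ?h \<in> pro_words" "pro_mult ?h \<one> \<in> pro_words"
        "pro_mult ?g ?h \<in> pro_words" "pro_mult ?h ?g \<in> pro_words"
        by (simp_all only: pro_mult_closed one_pro_words gh)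
      show "pro_mult \<one> ?g = ?g" by (rule pro_words_eqI_act[OF closed(1) gh(1) ex(1)])
      show "pro_mult ?g \<one> = ?g" by (rule pro_words_eqI_act[OF closed(2) gh(1) ex(2)])
      show "pro_mult \<one> ?h = ?h" by (rule pro_words_eqI_act[OF closed(3) gh(2) ex(3)])
      show "pro_mult ?h \<one> = ?h" by (rule pro_words_eqI_act[OF closed(4) gh(2) ex(4)])
      show "pro_mult ?g ?h = \<one>" by (rule pro_words_eqI_act[OF closed(5) one_pro_words ex(5)])
      show "pro_mult ?h ?g = \<one>" by (rule pro_words_eqI_act[OF closed(6) one_pro_words ex(6)])
    qed
    show ?thesis by (rule maximal_subgroup_unit[OF maximal gh eqs])
  qed
  show ?thesis
  proof (rule that[of x y W])
    fix r :: "letter list rel" assume "r \<in> fin_congs"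
    from fr[OF this] show "\<exists>n m u v w. frame \<one> r n m u v w \<and> u \<in> x r \<and> v \<in> y r \<and>
        (\<forall>c. (S ^^ n) [c] \<in> W c r)"
      by blast
  qed (fact P(1,2,3) xy gen)+
qed

end


section \<open>Generation modulo a congruence, and parity\<close>

lemma prefix_of_take: "prefix p u \<Longrightarrow> length p \<le> k \<Longrightarrow> take k u = take k w \<Longrightarrow> prefix p w"
  by (metis append_eq_conv_conj min.absorb1 prefix_def take_is_prefix take_take)

lemma suffix_of_take_rev:
  "suffix p u \<Longrightarrow> length p \<le> k \<Longrightarrow> take k (rev u) = take k (rev w) \<Longrightarrow> suffix p w"
  by (metis length_rev prefix_of_take suffix_to_prefix)

context letter_schuetzenberger
begin

text \<open>The idempotent \<open>y x\<close> is represented by a power of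
  \<open>\<phi>^N(a)\<close> with \<open>N\<close> large, which has the prefix and suffix that
  \<open>desubstitute\<close> requires. As \<open>h\<close> absorbs the idempotent on both sides, a
  congruence that sees the ends transfers them to a word of the language representing
  \<open>h\<close>.\<close>

lemma pow_desubstitute_in_idempotent:
  assumes e: "x \<in> pro_words" "y \<in> pro_words" "h \<in> pro_words" "r \<in> fin_congs"
    and fr: "\<And>r. r \<in> fin_congs \<Longrightarrow> \<exists>n m u v w. frame \<one> r n m u v w \<and> u \<in> x r \<and> v \<in> y r"
    and h: "adherent L h" "h = pro_mult (pro_mult (pro_mult y x) h) (pro_mult y x)"
  shows "\<exists>z. z \<noteq> [] \<and> (S ^^ n) z \<in> h r"
proof -
  define k where "k = length ((S ^^ n) [A, B]) + length ((S ^^ (2 * n)) [B])"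
  let ?t = "r \<inter> ends_cong k"
  have t: "?t \<in> fin_congs" using e(4) ends_cong_fin_congs by (rule Int_fin_congs)
  obtain n' m u v w' where fr': "frame \<one> ?t n' m u v w'" "u \<in> x ?t" "v \<in> y ?t" using fr[OF t] by blast
  \<comment> \<open>A multiple of \<open>n'\<close>, so that \<open>\<phi>^N(a)\<close> acts like
    \<open>\<phi>^n'(a)\<close>, and large enough to leave at least one \<open>\<phi>\<close> beyond
    the exponents \<open>n\<close> and \<open>2 * n\<close>.\<close>
  define N where "N = Suc (2 * n) * n'"
  have n': "n' \<ge> 2" using fr'(1) by (simp add: frame_def)
  then have N: "N \<ge> Suc (2 * n)" unfolding N_def by (metis Suc_leD mult.right_neutral mult_le_mono2 Suc_1)
  define p where "p = concat (replicate m ((S ^^ N) [A]))"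
  have "m \<ge> 2" using fr'(1) by (simp add: frame_def)
  then have m: "m = Suc (m - 1)" by simp
  have "act ?t ((S ^^ N) [A]) = act ?t ((S ^^ n') [A])"
    unfolding N_def using fr'(1) by (intro act_S_pow_mult[OF t]) (simp add: frame_def)
  then have p_act: "act ?t p = act ?t (v @ u)"
    using fr'(1) by (simp add: p_def act_replicate[OF t] frame_def)
  have ps: "p = (S ^^ N) [A] @ concat (replicate (m - 1) ((S ^^ N) [A]))"
    unfolding p_def by (subst m) simp
  have pe: "p = concat (replicate (m - 1) ((S ^^ N) [A])) @ (S ^^ N) [A]"
    unfolding p_def by (subst m) (simp only: replicate_append_same[symmetric] replicate_Suc concat_append concat.simps append_Nil2)
  have p: "act ?t p = act ?t (v @ u)" "prefix ((S ^^ N) [A]) p" "suffix ((S ^^ N) [A]) p"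
    using p_act ps pe unfolding prefix_def suffix_def by blast+
  have pne: "p \<noteq> []" using pe by simp
  let ?F = "pro_mult y x"
  have F: "?F \<in> pro_words" using e by blast
  have vu: "v @ u \<in> ?F ?t" using pro_mult_mem[OF e(2,1) t fr'(3,2)] .
  have "(v @ u, p) \<in> ?t"
    using p(1) act_eq_iff[OF t _ pne, of "v @ u"] fr'(1) by (simp add: frame_def)
  then have pF: "p \<in> ?F ?t" using pro_words_mem_iff[OF F t vu] by simp
  obtain w where w: "w \<in> L" "w \<in> h ?t" using h(1) t unfolding adherent_def by blast
  have Fh: "pro_mult ?F h \<in> pro_words" using F e(3) by blast
  have "(p @ w) @ p \<in> h ?t"
    using pro_mult_mem[OF Fh F t pro_mult_mem[OF F e(3) t pF w(2)] pF] h(2) by simp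
  then have "(p @ w @ p, w) \<in> ends_cong k"
    using pro_words_mem_iff[OF e(3) t] w(2) by auto
  then have tk: "take k (p @ w @ p) = take k w" "take k (rev (p @ w @ p)) = take k (rev w)"
    unfolding ends_cong_def by auto
  have S_le: "(S ^^ N) [A] = (S ^^ i) ((S ^^ Suc (N - i - 1)) [A])" if "i < N" for i
  proof -
    have "N = i + Suc (N - i - 1)" using that by simp
    then show ?thesis by (metis comp_apply funpow_add)
  qed
  have "prefix ((S ^^ n) [A, B]) ((S ^^ N) [A])"
  proof -
    obtain s where "(S ^^ (N - n - 1)) [A, B] = [A, B] @ s" using S_pow_starts by auto
    then have "(S ^^ Suc (N - n - 1)) [A] = [A, B] @ s"
      by (simp add: funpow_swap1)
    then have "(S ^^ N) [A] = (S ^^ n) [A, B] @ (S ^^ n) s"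
      using S_le[of n] N by (simp only: subst_ext_pow_append)
    then show ?thesis by (simp add: prefix_def)
  qed
  then have "prefix ((S ^^ n) [A, B]) (p @ w @ p)"
    using p(2) by (meson prefix_order.trans prefix_prefix)
  then have pre: "prefix ((S ^^ n) [A, B]) w"
    by (rule prefix_of_take[OF _ _ tk(1)]) (simp add: k_def)
  have "suffix ((S ^^ (2 * n)) [B]) ((S ^^ N) [A])"
  proof -
    obtain s where "(S ^^ Suc (N - 2 * n - 1)) [A] = s @ [B]"
      using S_shape[of "(S ^^ (N - 2 * n - 1)) [A]"] by auto
    then have "(S ^^ N) [A] = (S ^^ (2 * n)) s @ (S ^^ (2 * n)) [B]"
      using S_le[of "2 * n"] N by (simp only: subst_ext_pow_append)
    then show ?thesis by (simp add: suffix_def)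
  qed
  then have "suffix ((S ^^ (2 * n)) [B]) (p @ w @ p)"
    using p(3) by (meson suffix_appendI suffix_order.trans)
  then have suf: "suffix ((S ^^ (2 * n)) [B]) w"
    by (rule suffix_of_take_rev[OF _ _ tk(2)]) (simp add: k_def)
  obtain K where K: "\<And>k. k \<ge> K \<Longrightarrow> sublist w ((S ^^ k) [A])" using L_sublist[OF w(1)] by blast
  have "sublist w ((S ^^ (Suc K + n)) [A])" by (rule K) simp
  from desubstitute[OF this pre suf] obtain z where z: "w = (S ^^ n) z" by blast
  moreover have "w \<in> h r" using pro_words_mono[OF e(3) t e(4) _ w(2)] by blast
  moreover have "z \<noteq> []" using L_nonempty[OF w(1)] z by auto
  ultimately show ?thesis by blast
qed

text \<open>
  At a finite level every element is a product of copies of the two elements \<open>x W(c) y\<close>, and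
  each of these is itself such a product in which each of the two occurs an even number of times.
\<close>

lemma no_continuous_parity:
  assumes chi: "\<And>g h. g \<in> carrier G \<Longrightarrow> h \<in> carrier G \<Longrightarrow> chi (g \<otimes> h) \<longleftrightarrow> chi g \<noteq> chi h"
    and r: "r \<in> fin_congs" and cont: "\<And>g. g \<in> carrier G \<Longrightarrow> g r = \<one> r \<Longrightarrow> \<not> chi g"
    and g: "g \<in> carrier G"
  shows "\<not> chi g"
proof -
  obtain x y W where P: "x \<in> pro_words" "y \<in> pro_words" "\<And>c. W c \<in> pro_words"
    and xy: "pro_mult x y = \<one>" and gen: "\<And>c. pro_mult (pro_mult x (W c)) y \<in> carrier G"
    and fr: "\<And>r. r \<in> fin_congs \<Longrightarrow> \<exists>n m u v w. frame \<one> r n m u v w \<and> u \<in> x r \<and> v \<in> y r \<and>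
      (\<forall>c. (S ^^ n) [c] \<in> W c r)"
    using frames by metis
  define gen where "gen c = pro_mult (pro_mult x (W c)) y" for c
  have genG: "gen c \<in> carrier G" for c using gen by (simp add: gen_def)
  \<comment> \<open>By \<open>cont\<close>, applied to \<open>inv g \<otimes> h\<close>, the
    character takes equal values on elements that agree at level \<open>r\<close>.\<close>
  have level: "chi g \<longleftrightarrow> chi h" if gh: "g \<in> carrier G" "h \<in> carrier G" "g r = h r" for g h
  proof -
    have "(inv g \<otimes> h) r = (inv g \<otimes> g) r"
      unfolding mult_eq by (rule pro_mult_level_cong) (use gh r carrier_pro_words in auto)
    then have "(inv g \<otimes> h) r = \<one> r" using gh by simp
    then have "\<not> chi (inv g \<otimes> h)" "\<not> chi (inv g \<otimes> g)"
      using cont[of "inv g \<otimes> h"] cont[of "inv g \<otimes> g"] gh by simp_all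
    then show ?thesis
      using chi[OF inv_closed[OF gh(1)] gh(2)] chi[OF inv_closed[OF gh(1)] gh(1)] by simp
  qed
  obtain n m u v w where F: "frame \<one> r n m u v w" "u \<in> x r" "v \<in> y r" "\<And>c. (S ^^ n) [c] \<in> W c r"
    using fr[OF r] by blast
  have n: "n \<ge> 2" using F(1) by (simp add: frame_def)
  have gen_mem: "u @ (S ^^ n) [c] @ v \<in> gen c r" for c
  proof -
    have "u @ (S ^^ n) [c] \<in> pro_mult x (W c) r" by (rule pro_mult_mem[OF P(1,3) r F(2,4)])
    from pro_mult_mem[OF pro_mult_closed[OF P(1,3)] P(2) r this F(3)] show ?thesis
      by (simp add: gen_def)
  qed
  \<comment> \<open>Modulo \<open>r\<close>, \<open>u \<phi>^n(z) v\<close> is the product of the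
    generators indexed by the letters of \<open>z\<close>, as the inner \<open>v u\<close> are
    absorbed; so the character is a parity of letter counts.\<close>
  have word: "\<exists>g\<in>carrier G. u @ (S ^^ n) z @ v \<in> g r \<and>
      (chi g \<longleftrightarrow> (odd (count_list z A) \<and> chi (gen A)) \<noteq> (odd (count_list z B) \<and> chi (gen B)))"
    if "z \<noteq> []" for z
    using that
  proof (induction z rule: list_nonempty_induct)
    case (single c)
    show ?case
      using genG[of c] gen_mem[of c] by (intro bexI[of _ "gen c"]) (cases c; simp)+
  next
    case (cons c z)
    then obtain g where g: "g \<in> carrier G" "u @ (S ^^ n) z @ v \<in> g r"
      "chi g \<longleftrightarrow> (odd (count_list z A) \<and> chi (gen A)) \<noteq> (odd (count_list z B) \<and> chi (gen B))" by blast
    have prod: "gen c \<otimes> g \<in> carrier G" using genG g by simp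
    have "(u @ (S ^^ n) [c] @ v) @ (u @ (S ^^ n) z @ v) \<in> (gen c \<otimes> g) r"
      unfolding mult_eq
      by (rule pro_mult_mem[OF carrier_pro_words[OF genG] carrier_pro_words[OF g(1)] r gen_mem g(2)])
    moreover have "act r ((u @ (S ^^ n) [c] @ v) @ (u @ (S ^^ n) z @ v)) = act r (u @ (S ^^ n) (c # z) @ v)"
    proof -
      have "act r ((S ^^ n) [c] @ v @ u) = act r ((S ^^ n) [c])"
        using F(1) by (simp add: frame_def)
      then have "act r u * act r ((S ^^ n) [c] @ v @ u) * act r ((S ^^ n) z @ v) =
          act r u * act r ((S ^^ n) [c]) * act r ((S ^^ n) z @ v)"
        by simp
      then show ?thesis
        using subst_ext_pow_append[of n f "[c]" z] by (simp add: act_append[OF r] mult.assoc)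
    qed
    ultimately have "u @ (S ^^ n) (c # z) @ v \<in> (gen c \<otimes> g) r"
      using pro_words_mem_iff[OF carrier_pro_words[OF prod] r] act_eq_iff[OF r] by simp
    moreover have "chi (gen c \<otimes> g) \<longleftrightarrow> (odd (count_list (c # z) A) \<and> chi (gen A)) \<noteq>
        (odd (count_list (c # z) B) \<and> chi (gen B))"
      using chi[OF genG g(1)] g(3) by (cases c) auto
    ultimately show ?case using prod by blast
  qed
  \<comment> \<open>Modulo \<open>r\<close>, \<open>\<phi>^n(c)\<close> may be replaced by
    \<open>\<phi>^n(\<phi>^n(c))\<close>, a product over the letters of \<open>\<phi>^n(c)\<close>,
    where each letter occurs an even number of times.\<close>
  have chi_gen: "\<not> chi (gen c)" for c
  proof -
    obtain g where g: "g \<in> carrier G" "u @ (S ^^ n) ((S ^^ n) [c]) @ v \<in> g r" "\<not> chi g"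
      using word[of "(S ^^ n) [c]"] even_count_S_pow[OF n] by auto
    have "act r (u @ (S ^^ n) ((S ^^ n) [c]) @ v) = act r (u @ (S ^^ n) [c] @ v)"
      using F(1) by (simp add: frame_def act_append[OF r] funpow_add)
    then have "u @ (S ^^ n) [c] @ v \<in> g r"
      using pro_words_mem_iff[OF carrier_pro_words[OF g(1)] r g(2)] act_eq_iff[OF r] by simp
    then have "g r = gen c r"
      using pro_words_level_eqI[OF _ _ r] gen_mem carrier_pro_words genG g(1) by blast
    then show ?thesis using level[OF g(1) genG] g(3) by simp
  qed
  \<comment> \<open>Transport of \<open>g\<close> to the subgroup with identity \<open>y x\<close>,
    whose elements can be desubstituted; \<open>g\<close> is recovered as
    \<open>x h y\<close>.\<close>
  define h where "h = pro_mult (pro_mult y g) x"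
  have gP: "g \<in> pro_words" using carrier_pro_words[OF g] .
  have one_g: "pro_mult \<one> g = g" "pro_mult g \<one> = g" using l_one[OF g] r_one[OF g] by (simp_all add: mult_eq)
  have hP: "h \<in> pro_words" using P gP by (auto simp: h_def)
  have assoc: "pro_mult (pro_mult a b) c = pro_mult a (pro_mult b c)"
    if "a \<in> pro_words" "b \<in> pro_words" "c \<in> pro_words" for a b c :: "letter pro_word"
    using that by (rule pro_mult_assoc)
  have gh: "g = pro_mult x (pro_mult h y)"
  proof -
    have "pro_mult x (pro_mult h y) = pro_mult (pro_mult (pro_mult x y) g) (pro_mult x y)"
      unfolding h_def using P gP by (simp add: assoc pro_mult_closed)
    then show ?thesis by (simp add: xy one_g)
  qed
  have hF: "h = pro_mult (pro_mult (pro_mult y x) h) (pro_mult y x)"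
  proof -
    have "pro_mult (pro_mult (pro_mult y x) h) (pro_mult y x) =
        pro_mult (pro_mult y (pro_mult (pro_mult x y) (pro_mult g (pro_mult x y)))) x"
      unfolding h_def using P gP by (simp add: assoc pro_mult_closed)
    then show ?thesis by (simp add: xy one_g h_def)
  qed
  have "adherent L (pro_mult x (pro_mult h y))" using adherent_carrier[OF g] gh by simp
  from adherent_mult_factors(2)[OF this P(1) pro_mult_closed[OF hP P(2)] L_factors]
  have "adherent L (pro_mult h y)" .
  from adherent_mult_factors(1)[OF this hP P(2) L_factors]
  have adh: "adherent L h" .
  have "\<exists>n m u v w. frame \<one> s n m u v w \<and> u \<in> x s \<and> v \<in> y s" if "s \<in> fin_congs" for s
    using fr[OF that] by blast
  from pow_desubstitute_in_idempotent[OF P(1,2) hP r this adh hF]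
  obtain z where z: "z \<noteq> []" "(S ^^ n) z \<in> h r" by blast
  have "u @ (S ^^ n) z @ v \<in> g r"
    using pro_mult_mem[OF P(1) pro_mult_closed[OF hP P(2)] r F(2) pro_mult_mem[OF hP P(2) r z(2) F(3)]] gh
    by simp
  moreover obtain g' where g': "g' \<in> carrier G" "u @ (S ^^ n) z @ v \<in> g' r" "\<not> chi g'"
    using word[OF z(1)] chi_gen by blast
  ultimately have "g r = g' r"
    using pro_words_level_eqI[OF gP carrier_pro_words[OF g'(1)] r] by blast
  then show ?thesis using level[OF g g'(1)] g'(3) by simp
qed

end

section \<open>A finite quotient of even order\<close>

text \<open>
  The alternating group of degree 4 acts as an affine group on the plane over the field with two
  elements. As \<open>a\<close> acts by a map of order 3, the substitution does not change the action of \<open>b\<close>.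
\<close>

fun affine :: "letter \<Rightarrow> bool \<times> bool \<Rightarrow> bool \<times> bool" where
  "affine letter_a (p, q) = (q, p \<noteq> q)"
| "affine letter_b (p, q) = (\<not> p, q)"

definition affine_word :: "letter list \<Rightarrow> bool \<times> bool \<Rightarrow> bool \<times> bool" where
  "affine_word w = foldr (\<circ>) (map affine w) id"

lemma affine_word_append: "affine_word (u @ v) = affine_word u \<circ> affine_word v"
  by (induction u) (simp_all add: affine_word_def comp_assoc)

lemma affine_word_Cons: "affine_word (c # w) = affine c \<circ> affine_word w"
  by (simp add: affine_word_def)

lemma affine_word_Nil [simp]: "affine_word [] = id"
  by (simp add: affine_word_def)

lemma inj_affine_word: "inj (affine_word w)"
proof (induction w)
  case (Cons c w)
  have "inj (affine c)" by (rule injI, cases c) (auto elim!: affine.elims)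
  then show ?case unfolding affine_word_Cons using Cons by (rule inj_compose)
qed simp

lemma affine_b_b: "affine letter_b \<circ> affine letter_b = id"
  by (rule ext) auto

lemma affine_cubes:
  "affine letter_a \<circ> (affine letter_a \<circ> affine letter_a) = id"
  "(affine letter_a \<circ> affine letter_b) \<circ> ((affine letter_a \<circ> affine letter_b) \<circ> (affine letter_a \<circ> affine letter_b)) = id"
  by (rule ext, auto)+

definition affine_cong :: "letter list rel" where
  "affine_cong = {(u, v). u \<noteq> [] \<and> v \<noteq> [] \<and> affine_word u = affine_word v}"

lemma affine_cong_fin_congs: "affine_cong \<in> fin_congs"
  unfolding affine_cong_def by (rule kernel_fin_congs) (simp_all add: affine_word_append)

text \<open>As \<open>a\<close> and \<open>ab\<close> act with order 3 and \<open>b\<close> with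
  order 2, applying \<open>\<phi>\<close> fixes the action of \<open>b\<close> and exchanges those
  of \<open>a\<close> and \<open>ab\<close>, since \<open>abb\<close> acts like
  \<open>a\<close>.\<close>

lemma (in letter_substitution) affine_S_pow:
  "affine_word ((S ^^ n) [B]) = affine B \<and>
   (affine_word ((S ^^ n) [A]) = affine A \<or> affine_word ((S ^^ n) [A]) = affine A \<circ> affine B)"
proof (induction n)
  case (Suc n)
  have *: "(S ^^ Suc n) [A] = (S ^^ n) ([A] @ [B])" "(S ^^ Suc n) [B] = (S ^^ n) ([A] @ [A] @ [A] @ [B])"
    by (simp_all add: funpow_swap1)
  have "affine_word ((S ^^ n) [A]) \<circ> (affine_word ((S ^^ n) [A]) \<circ> affine_word ((S ^^ n) [A])) = id"
    using Suc affine_cubes by metis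
  then have "affine_word ((S ^^ Suc n) [B]) = affine B"
    unfolding * subst_ext_pow_append affine_word_append using Suc by (metis comp_assoc id_comp)
  moreover have "affine_word ((S ^^ Suc n) [A]) = affine_word ((S ^^ n) [A]) \<circ> affine B"
    unfolding * subst_ext_pow_append affine_word_append using Suc by simp
  then have "affine_word ((S ^^ Suc n) [A]) = affine A \<or>
      affine_word ((S ^^ Suc n) [A]) = affine A \<circ> affine B"
    using Suc affine_b_b by (metis comp_assoc comp_id)
  ultimately show ?case by blast
qed (simp add: affine_word_Cons)

context letter_schuetzenberger
begin

text \<open>The conjugate of the limit of \<open>\<phi>^n(b)\<close> is nontrivial with trivial
  square modulo \<open>affine_cong\<close>, so its odd powers agree with it there.\<close>

lemma ex_even_order:
  obtains g where "g \<in> carrier G" "\<And>k. odd k \<Longrightarrow> (g [^] (k :: nat)) affine_cong \<noteq> \<one> affine_cong"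
proof -
  let ?r = affine_cong
  note r = affine_cong_fin_congs
  obtain x y W where P: "x \<in> pro_words" "y \<in> pro_words" "\<And>c. W c \<in> pro_words"
    and xy: "pro_mult x y = \<one>" and gen: "\<And>c. pro_mult (pro_mult x (W c)) y \<in> carrier G"
    and fr: "\<And>r. r \<in> fin_congs \<Longrightarrow> \<exists>n m u v w. frame \<one> r n m u v w \<and> u \<in> x r \<and> v \<in> y r \<and>
      (\<forall>c. (S ^^ n) [c] \<in> W c r)"
    using frames by metis
  define g where "g = pro_mult (pro_mult x (W B)) y"
  have g: "g \<in> carrier G" using gen by (simp add: g_def)
  obtain n m u v w where F: "frame \<one> ?r n m u v w" "u \<in> x ?r" "v \<in> y ?r" "\<And>c. (S ^^ n) [c] \<in> W c ?r"
    using fr[OF r] by blast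
  define b where "b = (S ^^ n) [B]"
  have "u @ b \<in> pro_mult x (W B) ?r" unfolding b_def by (rule pro_mult_mem[OF P(1,3) r F(2,4)])
  from pro_mult_mem[OF pro_mult_closed[OF P(1,3)] P(2) r this F(3)]
  have gb: "u @ b @ v \<in> g ?r" by (simp add: g_def)
  have ne: "u \<noteq> []" "v \<noteq> []" using F(1) by (simp_all add: frame_def)
  have ab: "affine_word b = affine B" using affine_S_pow by (simp add: b_def)
  have one_mem: "u @ v \<in> \<one> ?r" using pro_mult_mem[OF P(1,2) r F(2,3)] xy by simp
  note gP = carrier_pro_words[OF g]
  have ne1: "g ?r \<noteq> \<one> ?r"
  proof
    assume "g ?r = \<one> ?r"
    then have "u @ b @ v \<in> \<one> ?r" using gb by simp
    then have "(u @ v, u @ b @ v) \<in> ?r" using pro_words_mem_iff[OF one_pro_words r one_mem] by blast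
    then have eq: "affine_word u \<circ> affine_word v = affine_word u \<circ> (affine B \<circ> affine_word v)"
      by (simp add: affine_cong_def affine_word_append ab)
    \<comment> \<open>Injectivity cancels \<open>u\<close>; but then the translation by which
      \<open>b\<close> acts would have a fixed point.\<close>
    have "affine_word v t = affine B (affine_word v t)" for t
      using fun_cong[OF eq, of t] injD[OF inj_affine_word] by simp
    then have "fst (affine_word v t) = fst (affine B (affine_word v t))" for t
      by simp
    then show False by (metis affine.simps(2) fst_conv surj_pair)
  qed
  have gg: "(g \<otimes> g) ?r = \<one> ?r"
  proof -
    have mem: "(u @ b @ v) @ (u @ b @ v) \<in> (g \<otimes> g) ?r"
      unfolding mult_eq by (rule pro_mult_mem[OF gP gP r gb gb])
    have bvu: "act ?r (b @ v @ u) = act ?r b" using F(1) by (simp add: frame_def b_def)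
    have "act ?r ((u @ b @ v) @ (u @ b @ v)) = act ?r u * act ?r (b @ v @ u) * act ?r b * act ?r v"
      by (simp add: act_append[OF r] mult.assoc)
    also have "\<dots> = act ?r (u @ b @ b @ v)"
      unfolding bvu by (simp add: act_append[OF r] mult.assoc)
    also have "\<dots> = act ?r (u @ v)"
    proof -
      have "affine_word (u @ b @ b @ v) = affine_word (u @ v)"
        using affine_b_b by (simp add: affine_word_append ab) (metis comp_assoc id_comp)
      then have "(u @ b @ b @ v, u @ v) \<in> ?r" using ne by (simp add: affine_cong_def)
      then show ?thesis using act_eq_iff[OF r] ne by simp
    qed
    finally have "((u @ b @ v) @ (u @ b @ v), u @ v) \<in> ?r"
      using act_eq_iff[OF r, of "(u @ b @ v) @ (u @ b @ v)" "u @ v"] ne by simp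
    moreover have ggP: "g \<otimes> g \<in> pro_words" using g carrier_pro_words by simp
    ultimately have "u @ v \<in> (g \<otimes> g) ?r" using pro_words_mem_iff[OF ggP r mem] by simp
    then show ?thesis using pro_words_level_eqI[OF ggP one_pro_words r] one_mem by blast
  qed
  have pow: "(g [^] (2 * j + 1 :: nat)) ?r = g ?r" for j :: nat
  proof (induction j)
    case (Suc j)
    have "g [^] (2 * Suc j + 1 :: nat) = g [^] (2 * j + 1 :: nat) \<otimes> (g \<otimes> g)"
      using g by (simp add: m_assoc)
    then have "(g [^] (2 * Suc j + 1 :: nat)) ?r = pro_mult (g [^] (2 * j + 1 :: nat)) (g \<otimes> g) ?r"
      by (simp only: mult_eq)
    also have "\<dots> = pro_mult g \<one> ?r"
      by (rule pro_mult_level_cong)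
        (use Suc gg g r carrier_pro_words one_pro_words in \<open>auto intro!: carrier_pro_words simp del: nat_pow_Suc\<close>)
    also have "pro_mult g \<one> = g" using r_one[OF g] by (simp add: mult_eq)
    finally show ?case .
  qed (use g in simp)
  show ?thesis
    by (rule that[OF g]) (metis ne1 oddE pow)
qed

end


section \<open>Relatively free profinite groups\<close>

lemma topspace_free_pro_topology [simp]: "topspace (free_pro_topology V X) = free_pro_carrier V X"
  by (auto simp: free_pro_topology_def free_pro_carrier_def)

lemma openin_free_pro_level:
  assumes "p \<in> generated_members V X"
  shows "openin (free_pro_topology V X) {z \<in> free_pro_carrier V X. z p = c}"
proof -
  let ?T = "product_topology (\<lambda>p. discrete_topology (carrier (fst p))) (generated_members V X)"
  have "continuous_map ?T (discrete_topology (carrier (fst p))) (\<lambda>z. z p)"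
    using continuous_map_product_projection[OF assms, of "\<lambda>p. discrete_topology (carrier (fst p))"]
    by simp
  then have "openin ?T {z \<in> topspace ?T. z p \<in> {c} \<inter> carrier (fst p)}"
    by (rule openin_continuous_map_preimage) simp
  then have "openin (free_pro_topology V X)
      (free_pro_carrier V X \<inter> {z \<in> topspace ?T. z p \<in> {c} \<inter> carrier (fst p)})"
    unfolding free_pro_topology_def by (rule openin_subtopology_Int2)
  moreover have "free_pro_carrier V X \<inter> {z \<in> topspace ?T. z p \<in> {c} \<inter> carrier (fst p)} =
      {z \<in> free_pro_carrier V X. z p = c}"
    using assms by (auto simp: free_pro_carrier_def)
  ultimately show ?thesis by simp
qed

text \<open>The finitely many coordinates are not merged into one member of the inverse system; the
  odd exponents found at the coordinates are merged instead.\<close>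

lemma openin_free_pro_topologyE:
  assumes "openin (free_pro_topology V X) U" "z \<in> U"
  obtains F where "finite F" "F \<subseteq> generated_members V X"
    "\<And>y. y \<in> free_pro_carrier V X \<Longrightarrow> (\<And>p. p \<in> F \<Longrightarrow> y p = z p) \<Longrightarrow> y \<in> U"
proof -
  let ?I = "generated_members V X"
  obtain U' where U': "openin (product_topology (\<lambda>p. discrete_topology (carrier (fst p))) ?I) U'"
    "U = U' \<inter> free_pro_carrier V X"
    using assms(1) by (auto simp: free_pro_topology_def openin_subtopology)
  then obtain B where B: "finite {p \<in> ?I. B p \<noteq> carrier (fst p)}"
    "z \<in> Pi\<^sub>E ?I B" "Pi\<^sub>E ?I B \<subseteq> U'"
    using assms(2) by (fastforce simp: openin_product_topology_alt)
  show ?thesis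
  proof (rule that[OF B(1)])
    fix y assume y: "y \<in> free_pro_carrier V X"
      "\<And>p. p \<in> {p \<in> ?I. B p \<noteq> carrier (fst p)} \<Longrightarrow> y p = z p"
    have "y p \<in> B p" if p: "p \<in> ?I" for p
    proof (cases "B p = carrier (fst p)")
      case True
      then show ?thesis using y(1) p by (auto simp: free_pro_carrier_def)
    next
      case False
      then show ?thesis using y(2)[of p] B(2) p by auto
    qed
    then have "y \<in> Pi\<^sub>E ?I B"
      using y(1) by (auto simp: free_pro_carrier_def PiE_def)
    then show "y \<in> U" using B(3) U'(2) y(1) by auto
  qed simp
qed

lemma generator_in_free_pro_carrier:
  assumes "i \<in> X"
  shows "(\<lambda>p\<in>generated_members V X. snd p i) \<in> free_pro_carrier V X"
  using assms by (auto simp: free_pro_carrier_def generated_members_def)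

lemma (in group) ex_involution:
  assumes "finite (carrier G)" "z \<in> carrier G" "\<And>k :: nat. odd k \<Longrightarrow> z [^] k \<noteq> \<one>"
  obtains t where "t \<in> carrier G" "t \<noteq> \<one>" "t \<otimes> t = \<one>"
proof -
  have "even (ord z)" using assms(2,3) pow_ord_eq_1 by blast
  then obtain j where j: "ord z = 2 * j" by blast
  have "ord z \<ge> 1" using ord_ge_1[OF assms(1,2)] .
  then have "\<not> ord z dvd j" using j by (auto dest: dvd_imp_le)
  then have "z [^] j \<noteq> \<one>" using pow_eq_id[OF assms(2)] by simp
  moreover have "z [^] j \<otimes> z [^] j = z [^] (2 * j)"
    using assms(2) by (simp add: nat_pow_mult mult_2)
  then have "z [^] j \<otimes> z [^] j = \<one>" using j assms(2) pow_ord_eq_1 by metis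
  ultimately show ?thesis using that[of "z [^] j"] assms(2) by simp
qed

lemma (in group) involution_subgroup:
  assumes "t \<in> carrier G" "t \<otimes> t = \<one>"
  shows "subgroup {\<one>, t} G"
proof -
  have "inv t = t" using assms inv_equality by blast
  then show ?thesis using assms by (intro subgroupI) auto
qed

lemma finite_common_odd_multiple:
  fixes P :: "'i \<Rightarrow> nat \<Rightarrow> bool"
  assumes "finite F" "\<And>i. i \<in> F \<Longrightarrow> \<exists>k. odd k \<and> P i k"
    and "\<And>i k l. i \<in> F \<Longrightarrow> P i k \<Longrightarrow> P i (k * l)"
  shows "\<exists>k. odd k \<and> (\<forall>i\<in>F. P i k)"
  using assms
proof (induction F)
  case empty
  show ?case by (intro exI[of _ 1]) simp
next
  case (insert i F)
  obtain k where k: "odd k" "\<forall>j\<in>F. P j k" using insert by auto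
  obtain l where l: "odd l" "P i l" using insert.prems(1)[of i] by blast
  have "\<forall>j\<in>insert i F. P j (k * l)"
    using k(2) insert.prems(2)[of _ k l] insert.prems(2)[of i l k] l(2) by (auto simp: mult.commute)
  then show ?case using k l by (intro exI[of _ "k * l"]) simp
qed

section \<open>Impossibility of relative freeness\<close>

context letter_schuetzenberger
begin

lemma not_relatively_free: "\<not> relatively_free G (schuetzenberger_topology G)"
proof
  assume "relatively_free G (schuetzenberger_topology G)"
  then obtain V and X :: "nat set" and h where V: "pseudovariety V" and h: "h \<in> iso G (free_pro V X)"
    and homeo: "homeomorphic_map (schuetzenberger_topology G) (free_pro_topology V X) h"
    unfolding relatively_free_def by blast
  let ?I = "generated_members V X"
  have member: "group (fst p)" "finite (carrier (fst p))" "fst p \<in> V" if "p \<in> ?I" for p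
    using that V[unfolded pseudovariety_def, THEN conjunct1] by (auto simp: generated_members_def)
  have topG: "topspace (schuetzenberger_topology G) = carrier G"
    using carrier_pro_words by (auto simp: schuetzenberger_topology_def)
  have bij: "bij_betw h (carrier G) (free_pro_carrier V X)"
    using h by (simp add: iso_def free_pro_def)
  then have h_carrier: "h x \<in> free_pro_carrier V X" if "x \<in> carrier G" for x
    using that bij_betwE by blast
  then have h_level: "h x p \<in> carrier (fst p)" if "x \<in> carrier G" "p \<in> ?I" for x p
    using that by (auto simp: free_pro_carrier_def)
  have h_mult: "h (x \<otimes> y) p = h x p \<otimes>\<^bsub>fst p\<^esub> h y p"
    if "x \<in> carrier G" "y \<in> carrier G" "p \<in> ?I" for x y p
    using h that by (simp add: iso_def hom_def free_pro_def product_group_def)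
  have h_one: "h \<one> p = \<one>\<^bsub>fst p\<^esub>" if p: "p \<in> ?I" for p
  proof -
    interpret K: group "fst p" using member(1)[OF p] .
    show ?thesis
      using h_mult[OF one_closed one_closed p] h_level[OF one_closed p] K.l_cancel_one' by simp
  qed
  have h_pow: "h (x [^] k) p = h x p [^]\<^bsub>fst p\<^esub> k" if "x \<in> carrier G" "p \<in> ?I" for x p and k :: nat
    using that by (induction k) (simp_all add: h_one h_mult)
  obtain g where g: "g \<in> carrier G" "\<And>k :: nat. odd k \<Longrightarrow> (g [^] k) affine_cong \<noteq> \<one> affine_cong"
    using ex_even_order by blast
  define U where "U = {x \<in> carrier G. x affine_cong = \<one> affine_cong}"
  have "U = carrier G \<inter> {x \<in> pro_words. x affine_cong = \<one> affine_cong}"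
    using carrier_pro_words by (auto simp: U_def)
  then have "openin (schuetzenberger_topology G) U"
    using openin_subtopology_Int2[OF openin_pro_level[OF affine_cong_fin_congs, of "\<one> affine_cong"]]
    by (simp add: schuetzenberger_topology_def)
  then have openU: "openin (free_pro_topology V X) (h ` U)"
    using homeomorphic_imp_open_map[OF homeo] by (auto simp: open_map_def)
  have oneU: "h \<one> \<in> h ` U" by (simp add: U_def)
  obtain F where F: "finite F" "F \<subseteq> ?I"
    "\<And>y. y \<in> free_pro_carrier V X \<Longrightarrow> (\<And>p. p \<in> F \<Longrightarrow> y p = h \<one> p) \<Longrightarrow> y \<in> h ` U"
    using openin_free_pro_topologyE[OF openU oneU] by blast
  \<comment> \<open>Otherwise a common odd exponent \<open>k\<close> would kill \<open>h g\<close>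
    at all coordinates in \<open>F\<close> and put \<open>g [^] k\<close> into \<open>U\<close>,
    which contains no odd power of \<open>g\<close>.\<close>
  have "\<exists>p\<in>F. \<forall>k :: nat. odd k \<longrightarrow> h g p [^]\<^bsub>fst p\<^esub> k \<noteq> \<one>\<^bsub>fst p\<^esub>"
  proof (rule ccontr)
    assume "\<not> ?thesis"
    then have ex: "\<exists>k :: nat. odd k \<and> h g p [^]\<^bsub>fst p\<^esub> k = \<one>\<^bsub>fst p\<^esub>" if "p \<in> F" for p
      using that by blast
    have mul: "h g p [^]\<^bsub>fst p\<^esub> (k * l) = \<one>\<^bsub>fst p\<^esub>"
      if "p \<in> F" "h g p [^]\<^bsub>fst p\<^esub> k = \<one>\<^bsub>fst p\<^esub>" for p and k l :: nat
    proof -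
      have p: "p \<in> ?I" using that(1) F(2) by blast
      interpret K: group "fst p" using member(1)[OF p] .
      show ?thesis
        using that(2) K.nat_pow_pow[OF h_level[OF g(1) p], of k l] by simp
    qed
    obtain k :: nat where k: "odd k" "\<forall>p\<in>F. h g p [^]\<^bsub>fst p\<^esub> k = \<one>\<^bsub>fst p\<^esub>"
      using finite_common_odd_multiple[OF F(1), of "\<lambda>p k. h g p [^]\<^bsub>fst p\<^esub> k = \<one>\<^bsub>fst p\<^esub>", OF ex mul]
      by blast
    have gk: "g [^] k \<in> carrier G" using g(1) by simp
    have "h (g [^] k) \<in> h ` U"
    proof (rule F(3)[OF h_carrier[OF gk]])
      fix p assume "p \<in> F"
      moreover from this have "p \<in> ?I" using F(2) by blast
      ultimately show "h (g [^] k) p = h \<one> p"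
        using k(2) h_pow[OF g(1), of p k] h_one by simp
    qed
    then have "g [^] k \<in> U"
      using bij gk by (auto simp: U_def bij_betw_def inj_on_def)
    then show False using g(2)[OF k(1)] by (simp add: U_def)
  qed
  then obtain p where p: "p \<in> ?I" "\<And>k :: nat. odd k \<Longrightarrow> h g p [^]\<^bsub>fst p\<^esub> k \<noteq> \<one>\<^bsub>fst p\<^esub>"
    using F(2) by blast
  define K where "K = fst p"
  interpret K: group K using member(1)[OF p(1)] by (simp add: K_def)
  have finK: "finite (carrier K)" using member(2)[OF p(1)] by (simp add: K_def)
  have hgp: "h g p \<in> carrier K" using h_level[OF g(1) p(1)] by (simp add: K_def)
  obtain t where t: "t \<in> carrier K" "t \<noteq> \<one>\<^bsub>K\<^esub>" "t \<otimes>\<^bsub>K\<^esub> t = \<one>\<^bsub>K\<^esub>"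
    using K.ex_involution[OF finK hgp] p(2) unfolding K_def by blast
  define Z where "Z = K\<lparr>carrier := {\<one>\<^bsub>K\<^esub>, t}\<rparr>"
  have subZ: "subgroup {\<one>\<^bsub>K\<^esub>, t} K" by (rule K.involution_subgroup[OF t(1,3)])
  then have "Z \<in> V"
    using V[unfolded pseudovariety_def, THEN conjunct2, THEN conjunct1] member(3)[OF p(1)]
    unfolding Z_def K_def by blast
  \<comment> \<open>A group generated by the empty set is trivial, whereas \<open>K\<close> contains
    the involution \<open>t\<close>.\<close>
  have "X \<noteq> {}"
  proof
    assume "X = {}"
    then have "generate K {} = carrier K"
      using p(1) by (auto simp: generated_members_def K_def)
    then show False using K.generate_empty t(1,2) by auto
  qed
  then obtain i where i: "i \<in> X" by blast
  \<comment> \<open>All generators go to \<open>t\<close>; the coordinate at \<open>q\<close> is the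
    homomorphism onto the group of order 2.\<close>
  define q where "q = (Z, \<lambda>i\<in>X. t)"
  have q: "q \<in> ?I"
  proof -
    have "(\<lambda>i\<in>X. t) ` X = {t}" using i by auto
    moreover have "generate Z {t} = {\<one>\<^bsub>K\<^esub>, t}"
    proof
      interpret Z: group Z unfolding Z_def by (rule K.subgroup_imp_group[OF subZ])
      show "generate Z {t} \<subseteq> {\<one>\<^bsub>K\<^esub>, t}"
        using Z.generate_incl[of "{t}"] by (simp add: Z_def)
      show "{\<one>\<^bsub>K\<^esub>, t} \<subseteq> generate Z {t}"
        using generate.one[of Z "{t}"] generate.incl[of t "{t}" Z] by (simp add: Z_def)
    qed
    ultimately show ?thesis
      using \<open>Z \<in> V\<close> by (auto simp: q_def generated_members_def Z_def)
  qed
  define chi where "chi x \<longleftrightarrow> h x q \<noteq> \<one>\<^bsub>K\<^esub>" for x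
  have chi: "chi (x \<otimes> y) \<longleftrightarrow> chi x \<noteq> chi y" if "x \<in> carrier G" "y \<in> carrier G" for x y
  proof -
    have "h (x \<otimes> y) q = h x q \<otimes>\<^bsub>K\<^esub> h y q"
      using h_mult[OF that q] by (simp add: q_def Z_def)
    moreover have "h x q \<in> {\<one>\<^bsub>K\<^esub>, t}" "h y q \<in> {\<one>\<^bsub>K\<^esub>, t}"
      using h_level[OF that(1) q] h_level[OF that(2) q] by (simp_all add: q_def Z_def)
    ultimately show ?thesis
      using t by (auto simp: chi_def)
  qed
  \<comment> \<open>The kernel of \<open>chi\<close> is open, so it contains all elements that agree
    with the identity at some level \<open>r\<close>.\<close>
  have "openin (schuetzenberger_topology G)
      {x \<in> topspace (schuetzenberger_topology G). h x \<in> {z \<in> free_pro_carrier V X. z q = \<one>\<^bsub>K\<^esub>}}"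
    by (rule openin_continuous_map_preimage[OF homeomorphic_imp_continuous_map[OF homeo]
        openin_free_pro_level[OF q]])
  then obtain W where W: "openin pro_topology W"
    "{x \<in> carrier G. h x \<in> {z \<in> free_pro_carrier V X. z q = \<one>\<^bsub>K\<^esub>}} = W \<inter> carrier G"
    unfolding topG by (auto simp: schuetzenberger_topology_def openin_subtopology)
  have "\<one> \<in> W"
    using W(2) h_one[OF q] h_carrier[OF one_closed] by (auto simp: q_def Z_def)
  then obtain r where r: "r \<in> fin_congs" "\<And>y. y \<in> pro_words \<Longrightarrow> y r = \<one> r \<Longrightarrow> y \<in> W"
    using openin_pro_topologyE[OF W(1)] by blast
  have cont: "\<not> chi x" if "x \<in> carrier G" "x r = \<one> r" for x
    using r(2)[OF carrier_pro_words[OF that(1)] that(2)] that(1) W(2) by (auto simp: chi_def)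
  \<comment> \<open>The free generator \<open>i\<close> has coordinate \<open>t\<close> at
    \<open>q\<close>, so \<open>chi\<close> holds on its preimage in \<open>G\<close>.\<close>
  have "(\<lambda>p\<in>?I. snd p i) \<in> h ` carrier G"
    using bij_betw_imp_surj_on[OF bij] generator_in_free_pro_carrier[OF i, of V] by simp
  then obtain x where x: "x \<in> carrier G" "h x = (\<lambda>p\<in>?I. snd p i)"
    by (rule imageE) (use that in simp)
  then have "chi x" using q i t(2) by (simp add: chi_def q_def)
  then show False using no_continuous_parity[of chi, OF chi r(1) cont x(1)] by blast
qed

end

theorem theorem7p2:
  fixes \<phi> :: "letter \<Rightarrow> letter list" and G :: "letter pro_word monoid"
  assumes "\<phi> letter_a = [letter_a, letter_b]"
    and "\<phi> letter_b = [letter_a, letter_a, letter_a, letter_b]"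
    and "schuetzenberger_group \<phi> G"
  shows "\<not> relatively_free G (schuetzenberger_topology G)"
proof -
  interpret letter_schuetzenberger \<phi> G
    using assms by unfold_locales
  show ?thesis by (rule not_relatively_free)
qed

end
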